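(* (In ZFC.) There is a twisted sum of $c_0$ and $c_0(\mathfrak c)$ which is not a $C$-space: there exist a Banach space $X$ that is not a $C$-space and a short exact sequence of Banach spaces and bounded linear operators $$0\longrightarrow c_0\longrightarrow X\longrightarrow c_0(\mathfrak c)\longrightarrow 0 .$$
   Context: A Banach space is a $C$-space if it is isomorphic (linearly homeomorphic) to the Banach space $C(K)$ of real-valued continuous functions on some compact Hausdorff space $K$. $\mathfrak c$ is the cardinality of the continuum. For a set $\Gamma$, $c_0(\Gamma)$ is the Banach space (supremum norm) of functions $x\colon\Gamma\to\mathbb R$ such that $\{\gamma\in\Gamma: |x(\gamma)|\ge\varepsilon\}$ is finite for every $\varepsilon>0$; $c_0=c_0(\omega)$. A short exact sequence $0\to Y\to Z\to X\to 0$ of Banach spaces is a diagram of bounded linear operators in which the kernel of each arrow is the image of the preceding one; $Z$ is then called a twisted sum of $Y$ and $X$. *)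

theory Defs
  imports "HOL-Analysis.Analysis"
begin

section \<open>Banach spaces on a carrier set\<close>

text \<open>
  A Banach space has to be the object of an existential quantifier, so the type class
  \<^class>\<open>banach\<close> cannot be used: spaces are records with an explicit carrier.
  A twisted sum of \<open>c\<^sub>0\<close> and \<open>c\<^sub>0(\<cc>)\<close> has exactly continuum many elements, so up to isomorphism each one
  has its carrier in a type of that size such as \<^typ>\<open>nat \<Rightarrow> real\<close>.
\<close>

record 'a normed_struct =
  vset :: "'a set"
  vzero :: 'a
  vadd :: "'a \<Rightarrow> 'a \<Rightarrow> 'a"
  vscale :: "real \<Rightarrow> 'a \<Rightarrow> 'a"
  vnorm :: "'a \<Rightarrow> real"

text \<open>The locale \<^locale>\<open>Metric_space\<close> wants distances to be nonnegative and symmetric off the carrier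
  as well, hence the conditional.\<close>

definition vdist :: "'a normed_struct \<Rightarrow> 'a \<Rightarrow> 'a \<Rightarrow> real" where
  "vdist V x y =
     (if x \<in> vset V \<and> y \<in> vset V then vnorm V (vadd V x (vscale V (- 1) y)) else 0)"

locale banach_space =
  fixes V :: "'a normed_struct"
  assumes zero_mem: "vzero V \<in> vset V"
    and add_mem: "\<lbrakk>x \<in> vset V; y \<in> vset V\<rbrakk> \<Longrightarrow> vadd V x y \<in> vset V"
    and scale_mem: "x \<in> vset V \<Longrightarrow> vscale V a x \<in> vset V"
    and add_assoc: "\<lbrakk>x \<in> vset V; y \<in> vset V; z \<in> vset V\<rbrakk>
      \<Longrightarrow> vadd V (vadd V x y) z = vadd V x (vadd V y z)"
    and add_commute: "\<lbrakk>x \<in> vset V; y \<in> vset V\<rbrakk> \<Longrightarrow> vadd V x y = vadd V y x"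
    and add_zero: "x \<in> vset V \<Longrightarrow> vadd V x (vzero V) = x"
    and add_neg: "x \<in> vset V \<Longrightarrow> vadd V x (vscale V (- 1) x) = vzero V"
    and scale_add_right: "\<lbrakk>x \<in> vset V; y \<in> vset V\<rbrakk>
      \<Longrightarrow> vscale V a (vadd V x y) = vadd V (vscale V a x) (vscale V a y)"
    and scale_add_left: "x \<in> vset V \<Longrightarrow> vscale V (a + b) x = vadd V (vscale V a x) (vscale V b x)"
    and scale_scale: "x \<in> vset V \<Longrightarrow> vscale V a (vscale V b x) = vscale V (a * b) x"
    and scale_one: "x \<in> vset V \<Longrightarrow> vscale V 1 x = x"
    and norm_eq_zero: "x \<in> vset V \<Longrightarrow> vnorm V x = 0 \<longleftrightarrow> x = vzero V"
    and norm_scale: "x \<in> vset V \<Longrightarrow> vnorm V (vscale V a x) = \<bar>a\<bar> * vnorm V x"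
    and norm_triangle: "\<lbrakk>x \<in> vset V; y \<in> vset V\<rbrakk> \<Longrightarrow> vnorm V (vadd V x y) \<le> vnorm V x + vnorm V y"
    and complete: "Metric_space.mcomplete (vset V) (vdist V)"

section \<open>Operators, isomorphisms and short exact sequences\<close>

definition bounded_operator ::
    "'a normed_struct \<Rightarrow> 'b normed_struct \<Rightarrow> ('a \<Rightarrow> 'b) \<Rightarrow> bool" where
  "bounded_operator V W T \<longleftrightarrow>
     T \<in> vset V \<rightarrow> vset W \<and>
     (\<forall>x\<in>vset V. \<forall>y\<in>vset V. T (vadd V x y) = vadd W (T x) (T y)) \<and>
     (\<forall>a. \<forall>x\<in>vset V. T (vscale V a x) = vscale W a (T x)) \<and>
     (\<exists>B. \<forall>x\<in>vset V. vnorm W (T x) \<le> B * vnorm V x)"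

definition operator_kernel ::
    "'a normed_struct \<Rightarrow> 'b normed_struct \<Rightarrow> ('a \<Rightarrow> 'b) \<Rightarrow> 'a set" where
  "operator_kernel V W T = {x \<in> vset V. T x = vzero W}"

definition isomorphic_spaces :: "'a normed_struct \<Rightarrow> 'b normed_struct \<Rightarrow> bool" where
  "isomorphic_spaces V W \<longleftrightarrow>
     (\<exists>T S. bounded_operator V W T \<and> bounded_operator W V S \<and>
        (\<forall>x\<in>vset V. S (T x) = x) \<and> (\<forall>y\<in>vset W. T (S y) = y))"

text \<open>Exactness of \<open>0 \<rightarrow> Y \<rightarrow> Z \<rightarrow> X \<rightarrow> 0\<close> with maps \<open>i\<close> and \<open>q\<close>, so \<open>Z\<close> is a twisted sum of
  \<open>Y\<close> and \<open>X\<close>: the three equations are exactness at \<open>Y\<close>, \<open>Z\<close> and \<open>X\<close>.\<close>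

definition short_exact_sequence ::
    "'a normed_struct \<Rightarrow> 'b normed_struct \<Rightarrow> 'c normed_struct \<Rightarrow> ('a \<Rightarrow> 'b) \<Rightarrow> ('b \<Rightarrow> 'c) \<Rightarrow> bool" where
  "short_exact_sequence Y Z X i q \<longleftrightarrow>
     banach_space Y \<and> banach_space Z \<and> banach_space X \<and>
     bounded_operator Y Z i \<and> bounded_operator Z X q \<and>
     operator_kernel Y Z i = {vzero Y} \<and>
     operator_kernel Z X q = i ` vset Y \<and>
     q ` vset Z = vset X"

section \<open>The spaces \<open>c\<^sub>0(\<Gamma>)\<close> and \<open>C(K)\<close>\<close>

text \<open>Inserting 0 only matters for \<open>S = {}\<close>, where the supremum of the empty set of reals is
  unspecified.\<close>

definition sup_norm :: "'s set \<Rightarrow> ('s \<Rightarrow> real) \<Rightarrow> real" where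
  "sup_norm S f = Sup (insert 0 ((\<lambda>s. \<bar>f s\<bar>) ` S))"

text \<open>Functions on \<open>S\<close> are represented by functions on the whole type that vanish outside \<open>S\<close>.\<close>

definition sup_normed_space :: "'s set \<Rightarrow> ('s \<Rightarrow> real) set \<Rightarrow> ('s \<Rightarrow> real) normed_struct" where
  "sup_normed_space S F =
     \<lparr>vset = {f \<in> F. \<forall>s. s \<notin> S \<longrightarrow> f s = 0}, vzero = (\<lambda>_. 0), vadd = (\<lambda>f g s. f s + g s),
      vscale = (\<lambda>a f s. a * f s), vnorm = sup_norm S\<rparr>"

definition c0_space :: "'g set \<Rightarrow> ('g \<Rightarrow> real) normed_struct" where
  "c0_space \<Gamma> = sup_normed_space \<Gamma> {x. \<forall>\<epsilon>>0. finite {\<gamma> \<in> \<Gamma>. \<bar>x \<gamma>\<bar> \<ge> \<epsilon>}}"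

definition C_of :: "'k topology \<Rightarrow> ('k \<Rightarrow> real) normed_struct" where
  "C_of K = sup_normed_space (topspace K) {f. continuous_map K euclideanreal f}"

text \<open>
  HOL cannot quantify over all types of points of \<open>K\<close> inside a formula. Taking
  \<^typ>\<open>'a \<Rightarrow> real\<close> for spaces \<open>V\<close> over \<^typ>\<open>'a\<close> loses nothing, as the points of \<open>K\<close> act as distinct
  functionals on \<open>V\<close>: see \<open>C_spaceI\<close>, where the points of \<open>K\<close> have an arbitrary type.
\<close>

definition C_space :: "'a normed_struct \<Rightarrow> bool" where
  "C_space V \<longleftrightarrow> (\<exists>K :: ('a \<Rightarrow> real) topology.
     compact_space K \<and> Hausdorff_space K \<and> isomorphic_spaces V (C_of K))"

lemma abs_le_sup_norm:
  assumes "\<And>s. s \<in> S \<Longrightarrow> \<bar>f s\<bar> \<le> B" "s \<in> S"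
  shows "\<bar>f s\<bar> \<le> sup_norm S f"
  unfolding sup_norm_def
proof (rule cSup_upper)
  show "bdd_above (insert 0 ((\<lambda>s. \<bar>f s\<bar>) ` S))"
    using assms(1) by (auto intro!: bdd_aboveI[where M = "max 0 B"] simp: le_max_iff_disj)
qed (use assms(2) in auto)

lemma sup_norm_le:
  assumes "\<And>s. s \<in> S \<Longrightarrow> \<bar>f s\<bar> \<le> B" "0 \<le> B"
  shows "sup_norm S f \<le> B"
  unfolding sup_norm_def using assms by (intro cSup_least) auto

lemma sup_norm_nonneg:
  assumes "\<And>s. s \<in> S \<Longrightarrow> \<bar>f s\<bar> \<le> B"
  shows "0 \<le> sup_norm S f"
  unfolding sup_norm_def
proof (rule cSup_upper)
  show "bdd_above (insert 0 ((\<lambda>s. \<bar>f s\<bar>) ` S))"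
    using assms(1) by (auto intro!: bdd_aboveI[where M = "max 0 B"] simp: le_max_iff_disj)
qed auto

lemma sup_norm_scale:
  assumes "\<And>s. s \<in> S \<Longrightarrow> \<bar>f s\<bar> \<le> B"
  shows "sup_norm S (\<lambda>s. a * f s) = \<bar>a\<bar> * sup_norm S f"
proof (rule antisym)
  note n = sup_norm_nonneg[of S f B, OF assms]
  show "sup_norm S (\<lambda>s. a * f s) \<le> \<bar>a\<bar> * sup_norm S f"
    using abs_le_sup_norm[of S f B, OF assms] n
    by (intro sup_norm_le) (auto simp: abs_mult mult_left_mono)
  show "\<bar>a\<bar> * sup_norm S f \<le> sup_norm S (\<lambda>s. a * f s)"
  proof (cases "a = 0")
    case True
    then show ?thesis by (simp add: sup_norm_nonneg[of _ _ 0])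
  next
    case False
    have b: "\<bar>a * f s\<bar> \<le> \<bar>a\<bar> * B" if "s \<in> S" for s
      using assms[OF that] by (simp add: abs_mult mult_left_mono)
    have "sup_norm S f \<le> sup_norm S (\<lambda>s. a * f s) / \<bar>a\<bar>"
    proof (rule sup_norm_le)
      fix s assume "s \<in> S"
      then show "\<bar>f s\<bar> \<le> sup_norm S (\<lambda>s. a * f s) / \<bar>a\<bar>"
        using abs_le_sup_norm[of S "\<lambda>s. a * f s", OF b] False
        by (simp add: field_simps abs_mult)
    next
      show "0 \<le> sup_norm S (\<lambda>s. a * f s) / \<bar>a\<bar>"
        using sup_norm_nonneg[of S "\<lambda>s. a * f s", OF b] by simp
    qed
    then show ?thesis using False by (simp add: field_simps)
  qed
qed

lemma banach_space_sup_normed: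
  fixes F :: "('s \<Rightarrow> real) set"
  assumes zero: "(\<lambda>_. 0) \<in> F"
    and add: "\<And>f g. \<lbrakk>f \<in> F; g \<in> F\<rbrakk> \<Longrightarrow> (\<lambda>s. f s + g s) \<in> F"
    and scale: "\<And>a f. f \<in> F \<Longrightarrow> (\<lambda>s. a * f s) \<in> F"
    and bounded: "\<And>f. f \<in> F \<Longrightarrow> \<exists>B. \<forall>s\<in>S. \<bar>f s\<bar> \<le> B"
    and closed: "\<And>g. (\<And>e. e > 0 \<Longrightarrow> \<exists>f\<in>F. \<forall>s\<in>S. \<bar>f s - g s\<bar> < e) \<Longrightarrow> g \<in> F"
  shows "banach_space (sup_normed_space S F)"
proof -
  let ?V = "sup_normed_space S F"
  let ?M = "vset ?V"
  have M: "f \<in> ?M \<longleftrightarrow> f \<in> F \<and> (\<forall>s. s \<notin> S \<longrightarrow> f s = 0)" for f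
    by (simp add: sup_normed_space_def)
  have diff: "(\<lambda>s. f s - g s) \<in> F" if "f \<in> F" "g \<in> F" for f g
    using add[OF that(1) scale[OF that(2), of "-1"]] by simp
  have d: "vdist ?V f g = sup_norm S (\<lambda>s. f s - g s)" if "f \<in> ?M" "g \<in> ?M" for f g
    using that by (simp add: vdist_def sup_normed_space_def)
  have le: "\<bar>f s\<bar> \<le> sup_norm S f" if "f \<in> F" "s \<in> S" for f s
    using bounded[OF that(1)] abs_le_sup_norm[of S f _ s] that(2) by blast
  have nn: "0 \<le> sup_norm S f" if "f \<in> F" for f
    using bounded[OF that(1)] sup_norm_nonneg[of S f] by blast
  have sc: "sup_norm S (\<lambda>s. a * f s) = \<bar>a\<bar> * sup_norm S f" if "f \<in> F" for a f
    using bounded[OF that(1)] sup_norm_scale[of S f] by blast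
  have tri: "sup_norm S (\<lambda>s. f s + g s) \<le> sup_norm S f + sup_norm S g" if "f \<in> F" "g \<in> F" for f g
  proof (rule sup_norm_le)
    fix s assume "s \<in> S"
    then show "\<bar>f s + g s\<bar> \<le> sup_norm S f + sup_norm S g"
      using le[OF that(1), of s] le[OF that(2), of s] by linarith
  qed (use nn that in force)
  have z: "sup_norm S f = 0 \<longleftrightarrow> f = (\<lambda>_. 0)" if "f \<in> ?M" for f
  proof
    assume "sup_norm S f = 0"
    then show "f = (\<lambda>_. 0)" using le[of f] that unfolding M by fastforce
  next
    assume "f = (\<lambda>_. 0)"
    then show "sup_norm S f = 0" using sc[OF zero, of 0] by simp
  qed
  interpret d: Metric_space ?M "vdist ?V"
  proof
    fix f g h assume f: "f \<in> ?M" and g: "g \<in> ?M"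
    have "(\<lambda>s. f s - g s) \<in> ?M" using f g diff unfolding M by auto
    then show "vdist ?V f g = 0 \<longleftrightarrow> f = g"
      using z[of "\<lambda>s. f s - g s"] unfolding d[OF f g] by (auto simp: fun_eq_iff)
    assume h: "h \<in> ?M"
    show "vdist ?V f h \<le> vdist ?V f g + vdist ?V g h"
      using tri[of "\<lambda>s. f s - g s" "\<lambda>s. g s - h s"] f g h diff
      unfolding d[OF f g] d[OF f h] d[OF g h] M by simp
  next
    fix f g
    show "vdist ?V f g = vdist ?V g f"
      using d[of f g] d[of g f] unfolding sup_norm_def
      by (cases "f \<in> ?M \<and> g \<in> ?M") (auto simp: abs_minus_commute vdist_def)
    show "0 \<le> vdist ?V f g"
      using d[of f g] nn[OF diff[of f g]] M
      by (cases "f \<in> ?M \<and> g \<in> ?M") (auto simp: vdist_def)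
  qed
  have "d.mcomplete"
    unfolding d.mcomplete_def
  proof (intro allI impI)
    fix \<sigma> assume C: "d.MCauchy \<sigma>"
    then have in_M: "\<sigma> n \<in> ?M" for n by (auto simp: d.MCauchy_def)
    have Cs: "\<exists>N. \<forall>m\<ge>N. \<forall>n\<ge>N. \<forall>s\<in>S. \<bar>\<sigma> m s - \<sigma> n s\<bar> < e" if "e > 0" for e
    proof -
      obtain N where N: "\<And>m n. \<lbrakk>N \<le> m; N \<le> n\<rbrakk> \<Longrightarrow> vdist ?V (\<sigma> m) (\<sigma> n) < e"
        using C \<open>e > 0\<close> unfolding d.MCauchy_def by blast
      have "\<bar>\<sigma> m s - \<sigma> n s\<bar> < e" if "N \<le> m" "N \<le> n" "s \<in> S" for m n s
        using N[OF that(1,2)] le[OF diff \<open>s \<in> S\<close>, of "\<sigma> m" "\<sigma> n"] in_M M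
        unfolding d[OF in_M in_M] by force
      then show ?thesis by blast
    qed
    define g where "g s = lim (\<lambda>n. \<sigma> n s)" for s
    have lim: "(\<lambda>n. \<sigma> n s) \<longlonglongrightarrow> g s" if "s \<in> S" for s
    proof -
      have "Cauchy (\<lambda>n. \<sigma> n s)"
        using Cs that by (intro CauchyI) (simp, meson)
      then show ?thesis
        unfolding g_def by (simp add: Cauchy_convergent_iff convergent_LIMSEQ_iff)
    qed
    have unif: "\<exists>N. \<forall>n\<ge>N. \<forall>s\<in>S. \<bar>\<sigma> n s - g s\<bar> \<le> e" if e: "e > 0" for e
    proof -
      obtain N where N: "\<And>m n s. \<lbrakk>N \<le> m; N \<le> n; s \<in> S\<rbrakk> \<Longrightarrow> \<bar>\<sigma> m s - \<sigma> n s\<bar> < e"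
        using Cs[OF e] by blast
      have "\<bar>\<sigma> n s - g s\<bar> \<le> e" if "N \<le> n" "s \<in> S" for n s
      proof (rule LIMSEQ_le_const2)
        show "(\<lambda>m. \<bar>\<sigma> n s - \<sigma> m s\<bar>) \<longlonglongrightarrow> \<bar>\<sigma> n s - g s\<bar>"
          by (intro tendsto_intros lim that)
        show "\<exists>K. \<forall>m\<ge>K. \<bar>\<sigma> n s - \<sigma> m s\<bar> \<le> e"
          using N[OF that(1) _ that(2)] by (meson less_imp_le)
      qed
      then show ?thesis by blast
    qed
    have "g \<in> F"
    proof (rule closed)
      fix e :: real assume "e > 0"
      then obtain N where "\<forall>n\<ge>N. \<forall>s\<in>S. \<bar>\<sigma> n s - g s\<bar> \<le> e / 2"
        using unif[of "e / 2"] by auto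
      then have "\<forall>s\<in>S. \<bar>\<sigma> N s - g s\<bar> < e" using \<open>e > 0\<close> by fastforce
      then show "\<exists>f\<in>F. \<forall>s\<in>S. \<bar>f s - g s\<bar> < e" using in_M M by blast
    qed
    moreover have "g s = 0" if "s \<notin> S" for s
      using in_M that unfolding g_def M by simp
    ultimately have g: "g \<in> ?M" by (simp add: M)
    have "limitin d.mtopology \<sigma> g sequentially"
      unfolding d.limitin_metric eventually_sequentially
    proof (intro conjI g allI impI)
      fix e :: real assume e: "e > 0"
      then obtain N where N: "\<And>n s. \<lbrakk>N \<le> n; s \<in> S\<rbrakk> \<Longrightarrow> \<bar>\<sigma> n s - g s\<bar> \<le> e / 2"
        using unif[of "e / 2"] by auto
      have "vdist ?V (\<sigma> n) g < e" if "N \<le> n" for n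
        using sup_norm_le[of S "\<lambda>s. \<sigma> n s - g s" "e / 2"] N[OF that] e
        unfolding d[OF in_M g] by force
      then show "\<exists>N. \<forall>n\<ge>N. \<sigma> n \<in> ?M \<and> vdist ?V (\<sigma> n) g < e" using in_M by blast
    qed
    then show "\<exists>x. limitin d.mtopology \<sigma> x sequentially" by blast
  qed
  then show ?thesis
  proof unfold_locales
    show "vnorm ?V x = 0 \<longleftrightarrow> x = vzero ?V" if "x \<in> ?M" for x
      using z[OF that] by (simp add: sup_normed_space_def)
    show "vnorm ?V (vscale ?V a x) = \<bar>a\<bar> * vnorm ?V x" if "x \<in> ?M" for x a
      using sc[of x a] that by (simp add: sup_normed_space_def)
    show "vnorm ?V (vadd ?V x y) \<le> vnorm ?V x + vnorm ?V y" if "x \<in> ?M" "y \<in> ?M" for x y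
      using tri[of x y] that by (simp add: sup_normed_space_def)
  qed (use zero add scale in \<open>auto simp: sup_normed_space_def algebra_simps\<close>)
qed

lemma banach_space_c0: "banach_space (c0_space \<Gamma>)"
  unfolding c0_space_def
proof (rule banach_space_sup_normed)
  fix f g :: "'a \<Rightarrow> real"
  assume f: "f \<in> {x. \<forall>\<epsilon>>0. finite {\<gamma> \<in> \<Gamma>. \<epsilon> \<le> \<bar>x \<gamma>\<bar>}}"
  show "\<exists>B. \<forall>s\<in>\<Gamma>. \<bar>f s\<bar> \<le> B"
  proof -
    have fin: "finite {\<gamma> \<in> \<Gamma>. 1 \<le> \<bar>f \<gamma>\<bar>}" using f by simp
    have "\<bar>f s\<bar> \<le> Max (insert 1 ((\<lambda>s. \<bar>f s\<bar>) ` {\<gamma> \<in> \<Gamma>. 1 \<le> \<bar>f \<gamma>\<bar>}))" if "s \<in> \<Gamma>" for s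
      using fin that by (cases "1 \<le> \<bar>f s\<bar>") (auto simp: Max_ge_iff)
    then show ?thesis by blast
  qed
  show "(\<lambda>s. a * f s) \<in> {x. \<forall>\<epsilon>>0. finite {\<gamma> \<in> \<Gamma>. \<epsilon> \<le> \<bar>x \<gamma>\<bar>}}" for a
  proof (cases "a = 0")
    case False
    have "{\<gamma> \<in> \<Gamma>. e \<le> \<bar>a * f \<gamma>\<bar>} = {\<gamma> \<in> \<Gamma>. e / \<bar>a\<bar> \<le> \<bar>f \<gamma>\<bar>}" for e
      using False by (auto simp: abs_mult field_simps)
    then show ?thesis using f False by simp
  qed (use f in \<open>auto simp: not_le[symmetric]\<close>)
  assume g: "g \<in> {x. \<forall>\<epsilon>>0. finite {\<gamma> \<in> \<Gamma>. \<epsilon> \<le> \<bar>x \<gamma>\<bar>}}"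
  have "finite {\<gamma> \<in> \<Gamma>. e \<le> \<bar>f \<gamma> + g \<gamma>\<bar>}" if "e > 0" for e
  proof (rule finite_subset)
    show "{\<gamma> \<in> \<Gamma>. e \<le> \<bar>f \<gamma> + g \<gamma>\<bar>}
        \<subseteq> {\<gamma> \<in> \<Gamma>. e / 2 \<le> \<bar>f \<gamma>\<bar>} \<union> {\<gamma> \<in> \<Gamma>. e / 2 \<le> \<bar>g \<gamma>\<bar>}" by auto
    have "0 < e / 2" using that by simp
    then show "finite ({\<gamma> \<in> \<Gamma>. e / 2 \<le> \<bar>f \<gamma>\<bar>} \<union> {\<gamma> \<in> \<Gamma>. e / 2 \<le> \<bar>g \<gamma>\<bar>})"
      using f g by blast
  qed
  then show "(\<lambda>s. f s + g s) \<in> {x. \<forall>\<epsilon>>0. finite {\<gamma> \<in> \<Gamma>. \<epsilon> \<le> \<bar>x \<gamma>\<bar>}}" by blast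
next
  fix g :: "'a \<Rightarrow> real"
  assume g: "\<exists>f\<in>{x. \<forall>\<epsilon>>0. finite {\<gamma> \<in> \<Gamma>. \<epsilon> \<le> \<bar>x \<gamma>\<bar>}}. \<forall>s\<in>\<Gamma>. \<bar>f s - g s\<bar> < e" if "e > 0" for e
  have "finite {\<gamma> \<in> \<Gamma>. e \<le> \<bar>g \<gamma>\<bar>}" if "e > 0" for e
  proof -
    have e: "0 < e / 2" using that by simp
    obtain f where f: "finite {\<gamma> \<in> \<Gamma>. e / 2 \<le> \<bar>f \<gamma>\<bar>}" "\<And>s. s \<in> \<Gamma> \<Longrightarrow> \<bar>f s - g s\<bar> < e / 2"
      using g[OF e] e by blast
    have "{\<gamma> \<in> \<Gamma>. e \<le> \<bar>g \<gamma>\<bar>} \<subseteq> {\<gamma> \<in> \<Gamma>. e / 2 \<le> \<bar>f \<gamma>\<bar>}"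
    proof clarify
      fix \<gamma> assume "\<gamma> \<in> \<Gamma>" "e \<le> \<bar>g \<gamma>\<bar>"
      then show "e / 2 \<le> \<bar>f \<gamma>\<bar>" using f(2)[of \<gamma>] by (simp add: abs_if split: if_splits)
    qed
    then show ?thesis using f(1) finite_subset by blast
  qed
  then show "g \<in> {x. \<forall>\<epsilon>>0. finite {\<gamma> \<in> \<Gamma>. \<epsilon> \<le> \<bar>x \<gamma>\<bar>}}" by blast
qed auto

lemma bounded_on_compact_space:
  assumes "compact_space K" "continuous_map K euclideanreal f"
  shows "\<exists>B. \<forall>s\<in>topspace K. \<bar>f s\<bar> \<le> B"
proof -
  have "compactin euclideanreal (f ` topspace K)"
    using assms image_compactin unfolding compact_space_def by blast
  then have "bounded (f ` topspace K)" by (simp add: compact_imp_bounded)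
  then show ?thesis by (auto simp: bounded_iff)
qed

lemma banach_space_C_of:
  assumes K: "compact_space K"
  shows "banach_space (C_of K)"
  unfolding C_of_def
proof (rule banach_space_sup_normed)
  show "\<exists>B. \<forall>s\<in>topspace K. \<bar>f s\<bar> \<le> B" if "f \<in> {f. continuous_map K euclideanreal f}" for f
    using bounded_on_compact_space[OF K] that by blast
  fix g
  assume g: "\<exists>f\<in>{f. continuous_map K euclideanreal f}. \<forall>s\<in>topspace K. \<bar>f s - g s\<bar> < e"
    if "e > 0" for e
  have "\<exists>f. continuous_map K euclideanreal f \<and> (\<forall>s\<in>topspace K. \<bar>f s - g s\<bar> < 1 / Suc n)" for n
    using g[of "1 / Suc n"] by force
  then obtain f where f: "\<And>n. continuous_map K euclideanreal (f n)"
    "\<And>n s. s \<in> topspace K \<Longrightarrow> \<bar>f n s - g s\<bar> < 1 / Suc n" by metis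
  have "continuous_map K Met_TC.mtopology g"
  proof (rule Met_TC.continuous_map_uniform_limit)
    show "\<forall>\<^sub>F n in sequentially. continuous_map K Met_TC.mtopology (f n)"
      using f(1) by simp
    fix e :: real assume "e > 0"
    then obtain N where N: "1 / Suc N < e" using nat_approx_posE by blast
    have "dist (f n s) (g s) < e" if "N \<le> n" "s \<in> topspace K" for n s
    proof -
      have "1 / real (Suc n) \<le> 1 / real (Suc N)" using that(1) by (simp add: field_simps)
      then show ?thesis using f(2)[OF that(2), of n] N by (simp add: dist_real_def)
    qed
    then show "\<forall>\<^sub>F n in sequentially. \<forall>x\<in>topspace K. g x \<in> UNIV \<and> dist (f n x) (g x) < e"
      unfolding eventually_sequentially by blast
  qed auto
  then show "g \<in> {f. continuous_map K euclideanreal f}" by simp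
qed (auto intro: continuous_map_add continuous_map_real_mult_left)

lemma bounded_operator_compose:
  assumes T: "bounded_operator U V T" and S: "bounded_operator V W S"
    and nonneg: "\<And>x. x \<in> vset V \<Longrightarrow> 0 \<le> vnorm V x"
  shows "bounded_operator U W (S \<circ> T)"
proof -
  obtain A B where A: "\<forall>x\<in>vset U. vnorm V (T x) \<le> A * vnorm U x"
    and B: "\<forall>x\<in>vset V. vnorm W (S x) \<le> B * vnorm V x"
    using T S unfolding bounded_operator_def by blast
  have mem: "T x \<in> vset V" if "x \<in> vset U" for x using T that unfolding bounded_operator_def by blast
  have "vnorm W (S (T x)) \<le> (\<bar>B\<bar> * A) * vnorm U x" if x: "x \<in> vset U" for x
  proof -
    have "vnorm W (S (T x)) \<le> B * vnorm V (T x)" using B mem[OF x] by blast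
    also have "\<dots> \<le> \<bar>B\<bar> * vnorm V (T x)"
      using nonneg[OF mem[OF x]] by (intro mult_right_mono) auto
    also have "\<dots> \<le> \<bar>B\<bar> * (A * vnorm U x)" using A x by (intro mult_left_mono) auto
    finally show ?thesis by (simp add: mult.assoc)
  qed
  then have "\<exists>B. \<forall>x\<in>vset U. vnorm W ((S \<circ> T) x) \<le> B * vnorm U x" by auto
  then show ?thesis
    using T S mem unfolding bounded_operator_def by (simp add: Pi_iff)
qed

lemma bounded_operator_C_of:
  assumes K: "compact_space K" and d: "continuous_map K' K d"
  shows "bounded_operator (C_of K) (C_of K') (\<lambda>f y. if y \<in> topspace K' then f (d y) else 0)"
    (is "bounded_operator _ _ ?T")
proof -
  have dK: "d y \<in> topspace K" if "y \<in> topspace K'" for y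
    using d that by (auto simp: continuous_map_def)
  have "?T f \<in> vset (C_of K')" if "f \<in> vset (C_of K)" for f
  proof -
    have "continuous_map K' euclideanreal (f \<circ> d)"
      using d that by (auto simp: C_of_def sup_normed_space_def intro: continuous_map_compose)
    then have "continuous_map K' euclideanreal (?T f)"
      by (rule continuous_map_eq) auto
    then show ?thesis by (simp add: C_of_def sup_normed_space_def)
  qed
  moreover have "vnorm (C_of K') (?T f) \<le> 1 * vnorm (C_of K) f" if f: "f \<in> vset (C_of K)" for f
  proof -
    obtain B where B: "\<And>s. s \<in> topspace K \<Longrightarrow> \<bar>f s\<bar> \<le> B"
      using bounded_on_compact_space[OF K, of f] f by (auto simp: C_of_def sup_normed_space_def)
    show ?thesis
      using abs_le_sup_norm[of "topspace K" f, OF B] sup_norm_nonneg[of "topspace K" f, OF B] dK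
      by (auto simp: C_of_def sup_normed_space_def intro!: sup_norm_le)
  qed
  then have "\<exists>B. \<forall>f\<in>vset (C_of K). vnorm (C_of K') (?T f) \<le> B * vnorm (C_of K) f" by blast
  ultimately show ?thesis
    unfolding bounded_operator_def by (auto simp: C_of_def sup_normed_space_def fun_eq_iff)
qed

lemma (in banach_space) norm_nonneg:
  assumes "x \<in> vset V"
  shows "0 \<le> vnorm V x"
proof -
  have "vnorm V (vzero V) = 0" using norm_eq_zero zero_mem by blast
  then show ?thesis
    using norm_triangle[OF assms scale_mem[OF assms, of "-1"]] norm_scale[OF assms, of "-1"]
      add_neg[OF assms] by simp
qed

theorem C_spaceI:
  fixes V :: "'a normed_struct" and K :: "'k topology"
  assumes K: "compact_space K" "Hausdorff_space K"
    and iso: "isomorphic_spaces V (C_of K)"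
  shows "C_space V"
proof -
  obtain T S where T: "bounded_operator V (C_of K) T" and S: "bounded_operator (C_of K) V S"
    and ST: "\<And>x. x \<in> vset V \<Longrightarrow> S (T x) = x" and TS: "\<And>f. f \<in> vset (C_of K) \<Longrightarrow> T (S f) = f"
    using iso unfolding isomorphic_spaces_def by blast
  define e where "e k = (\<lambda>x. T x k)" for k
  define A where "A = e ` topspace K"
  define d where "d = inv_into (topspace K) e"
  define K' where "K' = pullback_topology A d K"
  have inj: "inj_on e (topspace K)"
  proof (rule inj_onI, rule ccontr)
    fix k l assume kl: "k \<in> topspace K" "l \<in> topspace K" "e k = e l" "k \<noteq> l"
    have "completely_regular_space K"
      using K by (simp add: compact_Hausdorff_or_regular_imp_normal_space normal_imp_completely_regular_space)
    moreover have "closedin K {l}" using K kl by (simp add: closedin_Hausdorff_singleton)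
    ultimately obtain f where f: "continuous_map K euclideanreal f" "f k = 0" "f ` {l} \<subseteq> {1}"
      using kl unfolding completely_regular_space_alt by (metis DiffI singletonD)
    define h where "h s = (if s \<in> topspace K then f s else 0)" for s
    have "h \<in> vset (C_of K)"
      using continuous_map_eq[OF f(1), of h] by (simp add: h_def C_of_def sup_normed_space_def)
    then have "h k = h l" using TS[of h] fun_cong[OF kl(3), of "S h"] by (simp add: e_def)
    then show False using f kl by (simp add: h_def)
  qed
  have de: "d (e k) = k" if "k \<in> topspace K" for k
    using inj that by (simp add: d_def)
  have top: "topspace K' = A"
    using de by (auto simp: K'_def topspace_pullback_topology A_def)
  have cd: "continuous_map K' K d"
    using continuous_map_pullback[of K K id A d] by (simp add: K'_def)
  have ce: "continuous_map K K' e"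
    unfolding K'_def
  proof (rule continuous_map_pullback')
    show "continuous_map K K (d \<circ> e)"
      using continuous_map_eq[OF continuous_map_id, of K "d \<circ> e"] de by simp
  qed (auto simp: A_def)
  have "homeomorphic_maps K K' e d"
    using ce cd de top by (auto simp: homeomorphic_maps_def A_def)
  then have hom: "K homeomorphic_space K'" unfolding homeomorphic_space_def by blast
  have K': "compact_space K'" "Hausdorff_space K'"
    using K hom homeomorphic_compact_space homeomorphic_Hausdorff_space by blast+
  let ?P = "\<lambda>f y. if y \<in> topspace K' then f (d y) else 0"
  let ?Q = "\<lambda>f k. if k \<in> topspace K then f (e k) else 0"
  have P: "bounded_operator (C_of K) (C_of K') ?P" by (rule bounded_operator_C_of[OF K(1) cd])
  have Q: "bounded_operator (C_of K') (C_of K) ?Q" by (rule bounded_operator_C_of[OF K'(1) ce])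
  have nn: "0 \<le> vnorm (C_of K) f" if "f \<in> vset (C_of K)" for f
    using banach_space.norm_nonneg[OF banach_space_C_of[OF K(1)] that] .
  have QP: "?Q (?P f) = f" if "f \<in> vset (C_of K)" for f
    using that top de by (auto simp: A_def fun_eq_iff C_of_def sup_normed_space_def)
  have PQ: "?P (?Q f) = f" if "f \<in> vset (C_of K')" for f
    using that top de by (auto simp: A_def fun_eq_iff C_of_def sup_normed_space_def)
  have "isomorphic_spaces V (C_of K')"
    unfolding isomorphic_spaces_def
  proof (intro exI conjI ballI)
    show "bounded_operator V (C_of K') (?P \<circ> T)" by (rule bounded_operator_compose[OF T P nn])
    show "bounded_operator (C_of K') V (S \<circ> ?Q)" by (rule bounded_operator_compose[OF Q S nn])
    show "(S \<circ> ?Q) ((?P \<circ> T) x) = x" if "x \<in> vset V" for x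
      using QP[of "T x"] ST[OF that] T that by (simp add: bounded_operator_def Pi_iff)
    show "(?P \<circ> T) ((S \<circ> ?Q) f) = f" if f: "f \<in> vset (C_of K')" for f
    proof -
      have "?Q f \<in> vset (C_of K)" using Q f unfolding bounded_operator_def by blast
      then have "T (S (?Q f)) = ?Q f" by (rule TS)
      then have "(?P \<circ> T) ((S \<circ> ?Q) f) = ?P (?Q f)" by (simp only: comp_apply)
      then show ?thesis using PQ[OF f] by (rule trans)
    qed
  qed
  then show ?thesis using K' unfolding C_space_def by blast
qed

end

(*
  X is the space of sequences that lie, up to c_0 and uniform limits, in the span of {-1,0,1}-valued
  functions f p (p real) with almost disjoint infinite supports; x |-> (coefficient of f p in x)_p
  maps X onto c_0(c) with kernel c_0.

  Suppose T is an isomorphism of X onto C(K).  Choose points k_n with |T e_n (k_n)| >= delta and put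
  nu_n x = T x (k_n), a n m = nu_n e_m.  The rows of a are bounded in l_1, and nu_n (f p) is
  SUM m. a n m * f p m for all n and all but countably many p.  If for one such p there is a sequence
  n_j along which nu(f p) is close to c, -c, 0, c, -c, 0, ... while nu(f q) converges for every
  q ~= p, then nu(x) - t * nu(f p) almost converges for each x in X and suitable t.  But C(K) is
  closed under composition with phi(v) = max 0 (v/c - 1/2), so some y in X has
  nu(y) = phi(nu(f p)), and no t makes phi(v) - t v nearly constant on {c, -c, 0}.

  There are only continuum many pairs (a, g), where the g_i stand for the sequences nu(f q) with q
  in the countable exceptional set; each pair is assigned to uncountably many p, and f p is built by
  recursion along a well-order of the reals with short initial segments.  The support of f p lies in
  a branch of a countable tree.  Along a subsequence of the branch the measures |a n _| converge on
  all cones of the tree; the limit has countably many atoms among the branches, and away from them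
  every function supported by a branch automatically gives a convergent sequence.  The earlier
  functions living on atoms are dealt with by thinning out the sequence, and later branches are
  chosen off the atoms, as fewer than continuum many countable sets do not cover the reals.
*)

theory Submission
  imports Defs "HOL-Library.Diagonal_Subsequence"
begin

section \<open>Cardinality of the continuum\<close>

text \<open>The pairing function splits a set of naturals into a sequence of such sets; a bijection
  between these sets and the reals turns this into a coding of real sequences by reals.\<close>

lemma real_codes_sequences:
  "\<exists>E :: real \<Rightarrow> nat \<Rightarrow> real. surj E"
proof -
  obtain b :: "nat set \<Rightarrow> real" where b: "bij b"
    using nat_sets_eqpoll_reals unfolding eqpoll_def by blast
  define E where "E x n = b {k. prod_encode (n, k) \<in> inv b x}" for x n
  have "\<exists>x. h = E x" for h
  proof
    let ?x = "b {m. snd (prod_decode m) \<in> inv b (h (fst (prod_decode m)))}"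
    show "h = E ?x"
      using b by (auto simp: E_def fun_eq_iff bij_is_inj bij_is_surj surj_f_inv_f)
  qed
  then show ?thesis unfolding surj_def by blast
qed

text \<open>Fibres have to be uncountable because a countable exceptional set of indices is
  discarded later, and some index carrying the prescribed parameters must survive.\<close>

lemma real_codes_parameters:
  "\<exists>d :: real \<Rightarrow> (nat \<Rightarrow> nat \<Rightarrow> real) \<times> (nat \<Rightarrow> nat \<Rightarrow> real). \<forall>c. uncountable {p. d p = c}"
proof -
  obtain E :: "real \<Rightarrow> nat \<Rightarrow> real" where E: "surj E" using real_codes_sequences by blast
  \<comment> \<open>Position 0 of the coded sequence stays free, so every fibre of \<open>d\<close>
    maps onto the reals. Odd positions carry the first matrix, positive even positions the
    second.\<close>
  define d where "d p = ((\<lambda>i j. E p (Suc (2 * prod_encode (i, j)))),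
    (\<lambda>i j. E p (Suc (Suc (2 * prod_encode (i, j))))))" for p
  have "uncountable {p. d p = c}" for c
  proof
    assume count: "countable {p. d p = c}"
    have "s \<in> (\<lambda>p. E p 0) ` {p. d p = c}" for s
    proof -
      define h where "h n = (case n of 0 \<Rightarrow> s | Suc m \<Rightarrow>
        case_prod (if even m then fst c else snd c) (prod_decode (m div 2)))" for n
      obtain p where p: "E p = h" using E by (metis surjD)
      have "d p = c" by (auto simp: d_def p h_def)
      moreover have "E p 0 = s" by (simp add: p h_def)
      ultimately show ?thesis by blast
    qed
    then have "(\<lambda>p. E p 0) ` {p. d p = c} = UNIV" by blast
    then show False
      using countable_image[OF count, of "\<lambda>p. E p 0"] uncountable_UNIV_real by simp
  qed
  then show ?thesis by blast
qed

text \<open>A proper initial segment of a cardinal well-order of the reals has fewer than continuum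
  many elements, and so has the union of that many countable sets. In the recursion this yields a
  branch avoiding all earlier branches and atoms.\<close>

lemma ex_outside_small_union:
  includes cardinal_syntax
  fixes A :: "real \<Rightarrow> real set"
  assumes "\<And>q. countable (A q)"
  shows "\<exists>x. x \<notin> (\<Union>q\<in>underS |UNIV :: real set| p. A q)"
proof (rule ccontr)
  let ?I = "underS |UNIV :: real set| p"
  assume "\<not> ?thesis"
  then have U: "(\<Union>q\<in>?I. A q) = UNIV" by blast
  \<comment> \<open>Adjoining the naturals makes the bounding set infinite even if the segment is
    finite, and lets every countable \<open>A q\<close> inject into it.\<close>
  let ?B = "?I \<union> \<nat>"
  have inf: "infinite (\<nat> :: real set)" by (simp add: Nats_infinite)
  have small: "|?B| <o |UNIV :: real set|"
  proof (rule card_of_Un_ordLess_infinite)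
    show "infinite (UNIV :: real set)" by (simp add: infinite_UNIV_char_0)
    show "|?I| <o |UNIV :: real set|" by (rule card_of_underS[OF card_of_Card_order]) (simp only: Field_card_of UNIV_I)
    have "\<not> |UNIV :: real set| \<le>o |\<nat> :: real set|"
    proof
      assume "|UNIV :: real set| \<le>o |\<nat> :: real set|"
      then obtain f :: "real \<Rightarrow> real" where "inj f" "range f \<subseteq> \<nat>"
        unfolding card_of_ordLeq[symmetric] by blast
      moreover have "countable (\<nat> :: real set)" by (simp add: Nats_def)
      ultimately have "countable (UNIV :: real set)"
        using countable_image_inj_on countable_subset by blast
      then show False using uncountable_UNIV_real by simp
    qed
    then show "|\<nat> :: real set| <o |UNIV :: real set|"
      using not_ordLeq_iff_ordLess[OF card_of_Well_order card_of_Well_order] by blast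
  qed
  have "|\<Union>q\<in>?I. A q| \<le>o |?B|"
  proof (rule card_of_UNION_ordLeq_infinite)
    show "infinite ?B" using inf by simp
    show "|?I| \<le>o |?B|" by (intro card_of_mono1) auto
    have "|A q| \<le>o |?B|" for q
    proof -
      have "inj_on (\<lambda>y. real (to_nat_on (A q) y)) (A q)"
        using inj_on_to_nat_on[OF assms[of q]] by (auto simp: inj_on_def)
      then have "\<exists>f. inj_on f (A q) \<and> f ` A q \<subseteq> ?B" by (intro exI[of _ "\<lambda>y. real (to_nat_on (A q) y)"]) auto
      then show ?thesis by (simp only: card_of_ordLeq)
    qed
    then show "\<forall>q\<in>?I. |A q| \<le>o |?B|" by blast
  qed
  then have "|UNIV :: real set| <o |UNIV :: real set|"
    using small unfolding U by (rule ordLeq_ordLess_trans)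
  then show False by (simp add: ordLess_irreflexive)
qed

section \<open>Convergent sequences\<close>

lemma common_convergent_subsequence:
  fixes H :: "(nat \<Rightarrow> real) set"
  assumes H: "countable H" and bdd: "\<And>h. h \<in> H \<Longrightarrow> Bseq h"
  shows "\<exists>r. strict_mono r \<and> (\<forall>h\<in>H. convergent (\<lambda>j. h (r j)))"
proof (cases "H = {}")
  case True
  then show ?thesis using strict_mono_id by blast
next
  case False
  define k where "k n = from_nat_into H n" for n
  interpret subseqs "\<lambda>n r. convergent (\<lambda>j. k n (r j))"
  proof
    fix n and s :: "nat \<Rightarrow> nat" assume "strict_mono s"
    have "bounded (range (k n))"
      using bdd False unfolding k_def by (simp add: Bseq_eq_bounded from_nat_into)
    then have "bounded (range (\<lambda>j. k n (s j)))" by (rule bounded_subset) auto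
    then obtain l r where "strict_mono r" "((\<lambda>j. k n (s j)) \<circ> r) \<longlonglongrightarrow> l"
      using bounded_imp_convergent_subsequence by blast
    then show "\<exists>r'. strict_mono r' \<and> convergent (\<lambda>j. k n ((s \<circ> r') j))"
      by (auto simp: convergent_def o_def)
  qed
  have "convergent (\<lambda>j. k n (diagseq j))" for n
  proof -
    \<comment> \<open>The diagonal sequence refines the subsequence selected for \<open>k n\<close>
      only after a shift by \<open>Suc n\<close>; convergence ignores the terms cut off.\<close>
    have "convergent (\<lambda>j. k n ((diagseq \<circ> (+) (Suc n)) j))"
    proof (rule diagseq_holds)
      fix r s :: "nat \<Rightarrow> nat" and n
      assume "strict_mono r" "convergent (\<lambda>j. k n (s j))"
      then show "convergent (\<lambda>j. k n ((s \<circ> r) j))"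
        using convergent_subseq_convergent[of "\<lambda>j. k n (s j)" r] by (simp add: o_def)
    qed
    then have "convergent (\<lambda>j. k n (diagseq (j + Suc n)))" by (simp add: add.commute)
    then show ?thesis by (subst (asm) convergent_ignore_initial_segment)
  qed
  moreover have "\<exists>n. h = k n" if "h \<in> H" for h
    using H that from_nat_into_surj[of H h] unfolding k_def by metis
  ultimately show ?thesis using subseq_diagseq by metis
qed

lemma convergent_if_approximable:
  fixes u :: "nat \<Rightarrow> real"
  assumes "\<And>e. e > 0 \<Longrightarrow> \<exists>v. convergent v \<and> (\<forall>\<^sub>F j in sequentially. \<bar>u j - v j\<bar> < e)"
  shows "convergent u"
proof -
  have "Cauchy u"
  proof (rule metric_CauchyI)
    fix e :: real assume "e > 0"
    then have "e / 4 > 0" by simp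
    then obtain v where v: "convergent v" and "\<forall>\<^sub>F j in sequentially. \<bar>u j - v j\<bar> < e / 4"
      using assms by blast
    then obtain N where N: "\<And>j. j \<ge> N \<Longrightarrow> \<bar>u j - v j\<bar> < e / 4"
      by (auto simp: eventually_sequentially)
    obtain N' where N': "\<And>i j. i \<ge> N' \<Longrightarrow> j \<ge> N' \<Longrightarrow> \<bar>v i - v j\<bar> < e / 4"
      using convergent_Cauchy[OF v] \<open>e / 4 > 0\<close> unfolding Cauchy_def dist_real_def by blast
    have "\<bar>u i - u j\<bar> < e" if "i \<ge> max N N'" "j \<ge> max N N'" for i j
      using N[of i] N[of j] N'[of i j] that by (auto simp: abs_if split: if_splits)
    then show "\<exists>N. \<forall>m\<ge>N. \<forall>n\<ge>N. dist (u m) (u n) < e" unfolding dist_real_def by blast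
  qed
  then show ?thesis by (simp add: Cauchy_convergent_iff)
qed

section \<open>A countable tree with one branch for each real\<close>

text \<open>The node at level \<open>j\<close> is the list of the first \<open>j\<close> dyadic
  approximations of \<open>x\<close>, coded as a natural so that branches become sets of positions
  of a sequence. The root has a child for each integer; from level 1 on the tree is binary.\<close>

definition node :: "real \<Rightarrow> nat \<Rightarrow> nat" where
  "node x j = to_nat (map (\<lambda>i. \<lfloor>x * 2 ^ i\<rfloor>) [0..<j])"

lemma node_eq_iff: "node x i = node y j \<longleftrightarrow> i = j \<and> (\<forall>l<i. \<lfloor>x * 2 ^ l\<rfloor> = \<lfloor>y * 2 ^ l\<rfloor>)"
proof -
  have "node x i = node y j \<longleftrightarrow> map (\<lambda>i. \<lfloor>x * 2 ^ i\<rfloor>) [0..<i] = map (\<lambda>i. \<lfloor>y * 2 ^ i\<rfloor>) [0..<j]"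
    by (simp add: node_def)
  also have "\<dots> \<longleftrightarrow> i = j \<and> (\<forall>l<i. \<lfloor>x * 2 ^ l\<rfloor> = \<lfloor>y * 2 ^ l\<rfloor>)"
    by (auto simp: list_eq_iff_nth_eq)
  finally show ?thesis .
qed

text \<open>Equal floors at scale \<open>2 ^ l\<close> force
  \<open>\<bar>x - y\<bar> * 2 ^ l < 1\<close>, which fails for large \<open>l\<close>.\<close>

lemma nodes_separate:
  assumes "x \<noteq> y"
  shows "\<exists>J. node x J \<noteq> node y J"
proof (rule ccontr)
  assume "\<not> ?thesis"
  then have eq: "\<lfloor>x * 2 ^ l\<rfloor> = \<lfloor>y * 2 ^ l\<rfloor>" for l
    using node_eq_iff[of x "Suc l" y "Suc l"] by simp
  obtain l where l: "1 / \<bar>x - y\<bar> < 2 ^ l" using real_arch_pow[of 2] by auto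
  have "\<bar>(x - y) * 2 ^ l\<bar> < 1" using eq[of l] unfolding left_diff_distrib by linarith
  then have "\<bar>x - y\<bar> * 2 ^ l < 1" by (simp add: abs_mult)
  moreover have "1 < \<bar>x - y\<bar> * 2 ^ l"
    using l assms by (simp add: pos_divide_less_eq mult.commute)
  ultimately show False by simp
qed

lemma inj_node: "inj (node x)"
  by (simp add: inj_def node_eq_iff)

lemma node_mono: "node x j = node y j \<Longrightarrow> i \<le> j \<Longrightarrow> node x i = node y i"
  by (simp add: node_eq_iff)

text \<open>Branches that have separated never meet again, so all common nodes lie above the level
  of separation.\<close>

lemma branches_almost_disjoint:
  assumes "x \<noteq> y"
  shows "finite (range (node x) \<inter> range (node y))"
proof -
  obtain J where J: "node x J \<noteq> node y J" using nodes_separate[OF assms] by blast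
  have "range (node x) \<inter> range (node y) \<subseteq> node x ` {..<J}"
  proof
    fix m assume "m \<in> range (node x) \<inter> range (node y)"
    then obtain i where i: "m = node x i" "node x i = node y i" by (auto simp: node_eq_iff)
    then have "i < J" using J node_mono[of x i y J] by (meson not_le)
    then show "m \<in> node x ` {..<J}" using i by blast
  qed
  then show ?thesis by (rule finite_subset) simp
qed

text \<open>Codes of the nodes below the node with code \<open>c\<close> at level \<open>J\<close>.\<close>

definition node_cone :: "nat \<Rightarrow> nat \<Rightarrow> nat set" where
  "node_cone J c = {node y j |y j. J \<le> j \<and> node y J = c}"

text \<open>A node determines its ancestors. Hence cones at one level are disjoint, which bounds the
  sum of their masses by the total mass.\<close>

lemma node_cone_unique:
  assumes "m \<in> node_cone J c" "m \<in> node_cone J c'"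
  shows "c = c'"
proof -
  obtain y j where y: "m = node y j" "J \<le> j" "node y J = c"
    using assms(1) by (auto simp: node_cone_def)
  obtain z i where "m = node z i" "J \<le> i" "node z J = c'"
    using assms(2) by (auto simp: node_cone_def)
  then show ?thesis using y node_mono[of y j z J] node_eq_iff[of y j z i] by simp
qed

section \<open>Masses of cones and branches that are atoms of a limit measure\<close>

definition mass :: "(nat \<Rightarrow> real) \<Rightarrow> nat set \<Rightarrow> real" where
  "mass b C = (\<Sum>m. \<bar>b m\<bar> * indicator C m)"

lemma summable_mass:
  fixes b :: "nat \<Rightarrow> real"
  assumes "summable (\<lambda>m. \<bar>b m\<bar>)"
  shows "summable (\<lambda>m. \<bar>b m\<bar> * indicator C m)"
  by (rule summable_comparison_test'[OF assms, of 0]) (simp add: indicator_def)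

lemma mass_nonneg: "summable (\<lambda>m. \<bar>b m\<bar>) \<Longrightarrow> 0 \<le> mass b C"
  unfolding mass_def by (intro suminf_nonneg summable_mass) auto

lemma sum_mass_cones_le:
  assumes "summable (\<lambda>m. \<bar>b m\<bar>)" "finite S"
  shows "(\<Sum>c\<in>S. mass b (node_cone J c)) \<le> (\<Sum>m. \<bar>b m\<bar>)"
proof -
  have "(\<Sum>c\<in>S. mass b (node_cone J c)) = (\<Sum>m. \<Sum>c\<in>S. \<bar>b m\<bar> * indicator (node_cone J c) m)"
    unfolding mass_def by (rule suminf_sum[symmetric]) (rule summable_mass[OF assms(1)])
  also have "\<dots> \<le> (\<Sum>m. \<bar>b m\<bar>)"
  proof (rule suminf_le)
    show "summable (\<lambda>m. \<Sum>c\<in>S. \<bar>b m\<bar> * indicator (node_cone J c) m)"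
      by (intro summable_sum summable_mass assms)
    fix m
    have "(\<Sum>c\<in>S. indicator (node_cone J c) m :: real) = card {c \<in> S. m \<in> node_cone J c}"
      using assms(2) by (simp add: indicator_def sum.If_cases Int_def)
    moreover have "card {c \<in> S. m \<in> node_cone J c} \<le> Suc 0"
      using assms(2) node_cone_unique by (auto simp: card_le_Suc0_iff_eq)
    ultimately have "(\<Sum>c\<in>S. indicator (node_cone J c) m :: real) \<le> 1" by linarith
    then have "\<bar>b m\<bar> * (\<Sum>c\<in>S. indicator (node_cone J c) m) \<le> \<bar>b m\<bar> * 1"
      by (rule mult_left_mono) simp
    then show "(\<Sum>c\<in>S. \<bar>b m\<bar> * indicator (node_cone J c) m) \<le> \<bar>b m\<bar>"
      by (simp add: sum_distrib_left)
  qed (rule assms(1))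
  finally show ?thesis .
qed

text \<open>A pigeonhole argument: finitely many branches pass through distinct nodes at some level,
  so at most \<open>M * Suc k\<close> of them can carry mass \<open>1 / Suc k\<close> at all
  levels.\<close>

lemma countable_atoms:
  fixes l :: "nat \<Rightarrow> nat \<Rightarrow> real"
  assumes l: "\<And>J S. finite S \<Longrightarrow> (\<Sum>c\<in>S. l J c) \<le> M"
  shows "countable {y. \<exists>e>0. \<forall>J. e \<le> l J (node y J)}"
proof -
  define A where "A k = {y. \<forall>J. 1 / real (Suc k) \<le> l J (node y J)}" for k
  have "finite (A k)" for k
  proof (rule ccontr)
    assume "infinite (A k)"
    then obtain Y where Y: "Y \<subseteq> A k" "finite Y" "card Y = nat \<lceil>M * Suc k\<rceil> + 1"
      using infinite_arbitrarily_large by blast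
    have "\<forall>\<^sub>F J in sequentially. node x J \<noteq> node y J" if xy: "x \<noteq> y" for x y
    proof -
      obtain J where "node x J \<noteq> node y J" using nodes_separate[OF xy] by blast
      then show ?thesis using node_mono[of x _ y J] unfolding eventually_sequentially by blast
    qed
    then have "\<forall>\<^sub>F J in sequentially. \<forall>x\<in>Y. \<forall>y\<in>Y. x \<noteq> y \<longrightarrow> node x J \<noteq> node y J"
      using Y(2) by (intro eventually_ball_finite ballI) (auto intro: always_eventually elim: eventually_mono)
    then obtain J where "\<forall>x\<in>Y. \<forall>y\<in>Y. x \<noteq> y \<longrightarrow> node x J \<noteq> node y J"
      by (auto simp: eventually_sequentially)
    then have inj: "inj_on (\<lambda>y. node y J) Y" by (auto simp: inj_on_def)
    have "real (card Y) / Suc k = (\<Sum>y\<in>Y. 1 / real (Suc k))" by simp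
    also have "\<dots> \<le> (\<Sum>y\<in>Y. l J (node y J))" using Y(1) by (intro sum_mono) (auto simp: A_def)
    also have "\<dots> = (\<Sum>c\<in>(\<lambda>y. node y J) ` Y. l J c)" by (simp add: sum.reindex[OF inj])
    also have "\<dots> \<le> M" using Y(2) by (intro l) simp
    finally have "real (card Y) \<le> M * Suc k" by (simp add: field_simps)
    then show False using Y(3) by linarith
  qed
  then have "countable (\<Union>k. A k)" by (simp add: countable_finite)
  moreover have "{y. \<exists>e>0. \<forall>J. e \<le> l J (node y J)} \<subseteq> (\<Union>k. A k)"
  proof
    fix y assume "y \<in> {y. \<exists>e>0. \<forall>J. e \<le> l J (node y J)}"
    then obtain e where e: "e > 0" "\<And>J. e \<le> l J (node y J)" by blast
    obtain k where "1 / real (Suc k) < e" using nat_approx_posE[OF e(1)] .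
    then have "y \<in> A k" using e(2) by (auto simp: A_def intro: order.trans less_imp_le)
    then show "y \<in> (\<Union>k. A k)" by blast
  qed
  ultimately show ?thesis by (rule countable_subset[rotated])
qed

section \<open>Pairing summable rows with bounded functions\<close>

lemma summable_mult_bounded:
  fixes b h :: "nat \<Rightarrow> real"
  assumes "summable (\<lambda>m. \<bar>b m\<bar>)" "\<And>m. \<bar>h m\<bar> \<le> 1"
  shows "summable (\<lambda>m. b m * h m)"
proof (rule summable_comparison_test'[OF assms(1), of 0])
  show "norm (b m * h m) \<le> \<bar>b m\<bar>" for m
    using mult_left_mono[OF assms(2)[of m], of "\<bar>b m\<bar>"] by (simp add: abs_mult)
qed

lemma abs_suminf_mult_le:
  fixes b h :: "nat \<Rightarrow> real"
  assumes "summable (\<lambda>m. \<bar>b m\<bar>)" "\<And>m. \<bar>h m\<bar> \<le> 1"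
  shows "\<bar>\<Sum>m. b m * h m\<bar> \<le> (\<Sum>m. \<bar>b m\<bar>)"
proof -
  have le: "\<bar>b m * h m\<bar> \<le> \<bar>b m\<bar>" for m
    using mult_left_mono[OF assms(2)[of m], of "\<bar>b m\<bar>"] by (simp add: abs_mult)
  have s: "summable (\<lambda>m. \<bar>b m * h m\<bar>)"
    by (rule summable_comparison_test'[OF assms(1), of 0]) (use le in auto)
  have "\<bar>\<Sum>m. b m * h m\<bar> \<le> (\<Sum>m. \<bar>b m * h m\<bar>)" by (rule summable_rabs[OF s])
  also have "\<dots> \<le> (\<Sum>m. \<bar>b m\<bar>)" by (rule suminf_le[OF le s assms(1)])
  finally show ?thesis .
qed

text \<open>Apart from the first \<open>J\<close> nodes of the branch, the support of
  \<open>h\<close> stays inside one cone, so the mass of that cone bounds the error of the finite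
  sum.\<close>

lemma branch_sum_approx:
  fixes b h :: "nat \<Rightarrow> real"
  assumes b: "summable (\<lambda>m. \<bar>b m\<bar>)" and h: "\<And>m. \<bar>h m\<bar> \<le> 1"
    and supp: "\<And>m. m \<notin> range (node y) \<Longrightarrow> h m = 0"
  shows "\<bar>(\<Sum>m. b m * h m) - (\<Sum>m\<in>node y ` {..<J}. b m * h m)\<bar> \<le> mass b (node_cone J (node y J))"
proof -
  let ?F = "node y ` {..<J}" and ?C = "node_cone J (node y J)"
  have "(\<lambda>m. if m \<in> ?F then b m * h m else 0) sums (\<Sum>m\<in>?F. b m * h m)"
    by (rule sums_If_finite_set) simp
  then have "(\<lambda>m. b m * h m - (if m \<in> ?F then b m * h m else 0)) sums
      ((\<Sum>m. b m * h m) - (\<Sum>m\<in>?F. b m * h m))"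
    by (intro sums_diff summable_sums summable_mult_bounded[OF b h])
  then have "(\<Sum>m. b m * h m) - (\<Sum>m\<in>?F. b m * h m)
      = (\<Sum>m. b m * h m - (if m \<in> ?F then b m * h m else 0))"
    by (simp add: sums_iff)
  \<comment> \<open>The remainder becomes the row restricted to the cone, times a factor of modulus
    at most 1, which is the form \<open>abs_suminf_mult_le\<close> asks for.\<close>
  also have "\<dots> = (\<Sum>m. (\<bar>b m\<bar> * indicator ?C m) * (sgn (b m) * h m * (if m \<in> ?F then 0 else 1)))"
  proof (rule suminf_cong)
    fix m
    have "m \<in> ?C" if m: "m \<notin> ?F" "h m \<noteq> 0"
    proof -
      obtain l where "m = node y l" using supp m(2) by blast
      moreover have "J \<le> l" using calculation m(1) by (meson image_eqI lessThan_iff not_le)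
      ultimately show ?thesis by (auto simp: node_cone_def)
    qed
    then show "b m * h m - (if m \<in> ?F then b m * h m else 0)
        = (\<bar>b m\<bar> * indicator ?C m) * (sgn (b m) * h m * (if m \<in> ?F then 0 else 1))"
      by (cases "h m = 0") (auto simp: abs_mult_sgn mult_ac indicator_def abs_sgn)
  qed
  finally have eq: "(\<Sum>m. b m * h m) - (\<Sum>m\<in>?F. b m * h m)
      = (\<Sum>m. (\<bar>b m\<bar> * indicator ?C m) * (sgn (b m) * h m * (if m \<in> ?F then 0 else 1)))" .
  have "\<bar>\<dots>\<bar> \<le> (\<Sum>m. \<bar>\<bar>b m\<bar> * indicator ?C m\<bar>)"
  proof (rule abs_suminf_mult_le)
    show "summable (\<lambda>m. \<bar>\<bar>b m\<bar> * indicator ?C m\<bar>)"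
      using summable_mass[OF b] by (simp add: abs_mult)
    show "\<bar>sgn (b m) * h m * (if m \<in> ?F then 0 else 1)\<bar> \<le> 1" for m
      using h[of m] by (auto simp: abs_mult sgn_if)
  qed
  then show ?thesis unfolding eq by (simp add: mass_def abs_mult)
qed

text \<open>A form of Rosenthal's lemma: off the diagonal the matrix becomes negligible.\<close>

lemma sparse_subsequence:
  fixes b :: "nat \<Rightarrow> nat \<Rightarrow> real" and n :: "nat \<Rightarrow> nat"
  assumes col: "\<And>i. (\<lambda>j. b j i) \<longlonglongrightarrow> \<alpha> i" and \<alpha>: "\<alpha> \<longlonglongrightarrow> 0" and row: "\<And>j. b j \<longlonglongrightarrow> 0"
    and Q: "eventually Q sequentially" and n: "filterlim n at_top sequentially" and \<epsilon>: "0 < \<epsilon>"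
  shows "\<exists>t. strict_mono t \<and> strict_mono (n \<circ> t) \<and> (\<forall>j. Q (t j)) \<and>
    (\<forall>i j. i \<noteq> j \<longrightarrow> \<bar>b (t j) (t i)\<bar> \<le> \<epsilon> * (1 / 2) ^ i)"
proof -
  \<comment> \<open>A new index must itself have a small column limit \<open>\<alpha> v\<close>:
    this is what allows all later rows to be small in that column. Smallness of the new column in
    the earlier rows comes from \<open>row\<close>.\<close>
  define P where "P t j v \<longleftrightarrow> Q v \<and> \<bar>\<alpha> v\<bar> < \<epsilon> * (1 / 2) ^ j \<and>
    (\<forall>i\<in>{..<j}. t i < v \<and> n (t i) < n v \<and> \<bar>b v (t i)\<bar> < \<epsilon> * (1 / 2) ^ i \<and> \<bar>b (t i) v\<bar> < \<epsilon> * (1 / 2) ^ j)"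
    for t :: "nat \<Rightarrow> nat" and j v
  have small: "\<forall>\<^sub>F v in sequentially. \<bar>u v\<bar> < e" if "u \<longlonglongrightarrow> l" "\<bar>l\<bar> < e" for u and l e :: real
    using order_tendstoD(2)[OF tendsto_rabs[OF that(1)] that(2)] .
  have "\<exists>t. \<forall>j. P t j (t j)"
  proof (rule dependent_wellorder_choice)
    fix t j assume IH: "\<And>i. i < j \<Longrightarrow> P t i (t i)"
    have "\<forall>\<^sub>F v in sequentially. P t j v"
      unfolding P_def
    proof (intro eventually_conj eventually_ball_finite ballI Q)
      show "\<forall>\<^sub>F v in sequentially. \<bar>\<alpha> v\<bar> < \<epsilon> * (1 / 2) ^ j" using \<epsilon> by (intro small[OF \<alpha>]) simp
      fix i assume i: "i \<in> {..<j}"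
      show "\<forall>\<^sub>F v in sequentially. t i < v" by (rule eventually_gt_at_top)
      show "\<forall>\<^sub>F v in sequentially. n (t i) < n v"
        using n unfolding filterlim_at_top Suc_le_eq[symmetric] by blast
      show "\<forall>\<^sub>F v in sequentially. \<bar>b v (t i)\<bar> < \<epsilon> * (1 / 2) ^ i"
        using IH[of i] i by (intro small[OF col]) (auto simp: P_def)
      show "\<forall>\<^sub>F v in sequentially. \<bar>b (t i) v\<bar> < \<epsilon> * (1 / 2) ^ j"
        using \<epsilon> by (intro small[OF row]) simp
    qed auto
    then show "\<exists>v. P t j v" by (auto simp: eventually_sequentially)
  qed (auto simp: P_def)
  then obtain t where t: "\<And>j. P t j (t j)" by blast
  have "\<bar>b (t j) (t i)\<bar> \<le> \<epsilon> * (1 / 2) ^ i" if "i \<noteq> j" for i j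
    using t[of i] t[of j] that unfolding P_def by (cases "i < j") (auto intro: less_imp_le)
  then show ?thesis
    using t by (intro exI[of _ t]) (auto simp: P_def strict_mono_def)
qed

section \<open>Functions on a branch\<close>

text \<open>Period three and not two: on a two-point set every function is affine, so two limit
  values could not exclude a correction of the form \<open>t * v\<close> plus a convergent
  sequence.\<close>

definition sign_pattern :: "nat \<Rightarrow> real" where
  "sign_pattern j = (if j mod 3 = 0 then 1 else if j mod 3 = 1 then - 1 else 0)"

lemma sign_pattern_mem: "sign_pattern j \<in> {- 1, 0, 1}"
  by (simp add: sign_pattern_def)

lemma abs_sign_pattern_le: "\<bar>sign_pattern j\<bar> \<le> 1"
  by (simp add: sign_pattern_def)

lemma abs_le_half_power_sum:
  fixes w :: "nat \<Rightarrow> real"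
  assumes w: "\<And>i. i \<noteq> j \<Longrightarrow> \<bar>w i\<bar> \<le> e * (1 / 2) ^ i" and e: "0 \<le> e"
  shows "summable w" "\<bar>(\<Sum>i. w i) - w j\<bar> \<le> 2 * e"
proof -
  have g: "(\<lambda>i. e * (1 / 2) ^ i) sums (2 * e)"
    using sums_mult[OF geometric_sums[of "1 / 2 :: real"], of e] by (simp add: mult.commute)
  let ?v = "\<lambda>i. if i = j then 0 else w i"
  have v: "norm (?v i) \<le> e * (1 / 2) ^ i" for i using w e by simp
  have s: "summable ?v" by (rule summable_comparison_test'[OF sums_summable[OF g]]) (rule v)
  have "\<bar>\<Sum>i. ?v i\<bar> \<le> 2 * e"
    using norm_suminf_le[OF v sums_summable[OF g]] sums_unique[OF g] by simp
  moreover have "(\<lambda>i. ?v i + (if i = j then w i else 0)) sums ((\<Sum>i. ?v i) + w j)"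
    by (intro sums_add summable_sums s sums_single)
  then have "w sums ((\<Sum>i. ?v i) + w j)" by (rule sums_cong[THEN iffD1, rotated]) simp
  ultimately show "summable w" "\<bar>(\<Sum>i. w i) - w j\<bar> \<le> 2 * e" by (auto simp: sums_iff)
qed

text \<open>The sign pattern is placed on a sparse subsequence of \<open>n\<close>. In each selected
  row the diagonal term contributes nearly \<open>c * sign_pattern j\<close>, and the other terms
  add up to a small error.\<close>

lemma branch_function:
  fixes a :: "nat \<Rightarrow> nat \<Rightarrow> real" and n :: "nat \<Rightarrow> nat"
  assumes "inj n" and summ: "\<And>k. summable (\<lambda>m. \<bar>a k m\<bar>)" and bound: "\<And>k. (\<Sum>m. \<bar>a k m\<bar>) \<le> M"
    and col: "\<And>m. convergent (\<lambda>j. a (n j) m)"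
    and diag: "(\<lambda>j. a (n j) (n j)) \<longlonglongrightarrow> c" and c: "c \<noteq> 0"
  shows "\<exists>t f. strict_mono t \<and> (\<forall>j. f (n (t j)) = sign_pattern j) \<and>
    (\<forall>m. m \<notin> range (n \<circ> t) \<longrightarrow> f m = 0) \<and>
    (\<forall>j. \<bar>(\<Sum>m. a (n (t j)) m * f m) - c * sign_pattern j\<bar> \<le> \<bar>c\<bar> / 8)"
proof -
  define b where "b j i = a (n j) (n i)" for j i
  obtain \<alpha> where \<alpha>: "\<And>m. (\<lambda>j. a (n j) m) \<longlonglongrightarrow> \<alpha> m" using col unfolding convergent_def by metis
  have n: "filterlim n at_top sequentially"
    unfolding filterlim_at_top eventually_sequentially
  proof
    fix Z
    have "finite (n -` {..<Z})" using \<open>inj n\<close> by (intro finite_vimageI) auto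
    then obtain k where "\<forall>i\<in>n -` {..<Z}. i < k" using finite_nat_set_iff_bounded by blast
    then show "\<exists>N. \<forall>i\<ge>N. Z \<le> n i" by (intro exI[of _ k]) (auto simp: not_less[symmetric])
  qed
  \<comment> \<open>The column limits inherit the bound \<open>M\<close> on partial sums, hence they
    tend to 0, as the sparse selection requires.\<close>
  have "summable (\<lambda>m. \<bar>\<alpha> m\<bar>)"
  proof (rule summableI_nonneg_bounded)
    fix N
    have "(\<lambda>j. \<Sum>m<N. \<bar>a (n j) m\<bar>) \<longlonglongrightarrow> (\<Sum>m<N. \<bar>\<alpha> m\<bar>)" by (intro tendsto_intros \<alpha>)
    moreover have "(\<Sum>m<N. \<bar>a (n j) m\<bar>) \<le> M" for j
      using sum_le_suminf[OF summ[of "n j"], of "{..<N}"] bound[of "n j"] by simp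
    ultimately show "(\<Sum>m<N. \<bar>\<alpha> m\<bar>) \<le> M" by (intro LIMSEQ_le_const2) auto
  qed auto
  then have "(\<lambda>m. \<bar>\<alpha> m\<bar>) \<longlonglongrightarrow> 0" by (rule summable_LIMSEQ_zero)
  then have \<alpha>0: "(\<lambda>i. \<alpha> (n i)) \<longlonglongrightarrow> 0"
    using filterlim_compose[OF _ n, of \<alpha> "nhds 0"] by (simp add: tendsto_rabs_zero_iff)
  have row: "b j \<longlonglongrightarrow> 0" for j
    using filterlim_compose[OF _ n, of "a (n j)" "nhds 0"] summable_LIMSEQ_zero[OF summ[of "n j"]]
    by (simp add: b_def[abs_def] tendsto_rabs_zero_iff)
  \<comment> \<open>The off-diagonal error is at most \<open>2 * (\<bar>c\<bar> / 32)\<close> and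
    the diagonal error at most \<open>\<bar>c\<bar> / 32\<close>, together below
    \<open>\<bar>c\<bar> / 8\<close>.\<close>
  have e: "0 < \<bar>c\<bar> / 32" using c by simp
  have "\<forall>\<^sub>F j in sequentially. \<bar>b j j - c\<bar> < \<bar>c\<bar> / 32"
    using tendstoD[OF diag e] by (simp add: dist_real_def b_def)
  from sparse_subsequence[OF _ \<alpha>0 row this n e, unfolded b_def, OF \<alpha>]
  obtain t where t: "strict_mono t" "strict_mono (n \<circ> t)"
    and td: "\<And>j. \<bar>b (t j) (t j) - c\<bar> < \<bar>c\<bar> / 32"
    and to: "\<And>i j. i \<noteq> j \<Longrightarrow> \<bar>b (t j) (t i)\<bar> \<le> \<bar>c\<bar> / 32 * (1 / 2) ^ i"
    unfolding b_def by blast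
  define f where "f m = (if m \<in> range (n \<circ> t) then sign_pattern (the_inv (n \<circ> t) m) else 0)" for m
  have f: "f (n (t j)) = sign_pattern j" for j
    using the_inv_f_f[OF strict_mono_imp_inj_on[OF t(2)], of j] by (auto simp: f_def)
  have "\<bar>(\<Sum>m. a (n (t j)) m * f m) - c * sign_pattern j\<bar> \<le> \<bar>c\<bar> / 8" for j
  proof -
    let ?w = "\<lambda>i. b (t j) (t i) * sign_pattern i"
    have "(\<Sum>i. a (n (t j)) ((n \<circ> t) i) * f ((n \<circ> t) i)) = (\<Sum>m. a (n (t j)) m * f m)"
      by (rule suminf_mono_reindex[OF t(2)]) (simp add: f_def)
    then have "(\<Sum>m. a (n (t j)) m * f m) = suminf ?w" by (simp add: f b_def)
    moreover have "\<bar>suminf ?w - ?w j\<bar> \<le> 2 * (\<bar>c\<bar> / 32)"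
    proof (rule abs_le_half_power_sum(2))
      fix i assume "i \<noteq> j"
      have "\<bar>?w i\<bar> \<le> \<bar>b (t j) (t i)\<bar>"
        using mult_left_mono[OF abs_sign_pattern_le, of "\<bar>b (t j) (t i)\<bar>"] by (simp add: abs_mult)
      then show "\<bar>?w i\<bar> \<le> \<bar>c\<bar> / 32 * (1 / 2) ^ i" using to[OF \<open>i \<noteq> j\<close>] by linarith
    qed simp
    moreover have "\<bar>?w j - c * sign_pattern j\<bar> \<le> \<bar>c\<bar> / 32"
      using td[of j] by (simp add: sign_pattern_def abs_minus_commute)
    ultimately show ?thesis by linarith
  qed
  then show ?thesis using t(1) f by (intro exI[of _ t] exI[of _ f]) (auto simp: f_def)
qed

text \<open>The rows of \<open>a\<close> stand for the functionals \<open>\<nu>\<^sub>n\<close> on \<open>c\<^sub>0\<close>, the sequences \<open>g i\<close> for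
  the values of \<open>\<nu>\<^sub>n\<close> at those members of the family where \<open>\<nu>\<^sub>n\<close> is not given by \<open>a\<close>.\<close>

definition admissible :: "(nat \<Rightarrow> nat \<Rightarrow> real) \<Rightarrow> (nat \<Rightarrow> nat \<Rightarrow> real) \<Rightarrow> bool" where
  "admissible a g \<longleftrightarrow> (\<exists>M. \<forall>n. summable (\<lambda>m. \<bar>a n m\<bar>) \<and> (\<Sum>m. \<bar>a n m\<bar>) \<le> M) \<and>
    (\<exists>\<delta>>0. \<forall>n. \<delta> \<le> \<bar>a n n\<bar>) \<and> (\<forall>i. Bseq (g i))"

text \<open>Convergence of the \<open>g i\<close> and of the columns is recorded because both enter
  the convergent correction term when the values at a general element of the twisted sum are
  compared with those at \<open>f\<close>.\<close>

definition tested_along ::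
    "(nat \<Rightarrow> nat \<Rightarrow> real) \<Rightarrow> (nat \<Rightarrow> nat \<Rightarrow> real) \<Rightarrow> (nat \<Rightarrow> real) \<Rightarrow> (nat \<Rightarrow> nat) \<Rightarrow> real \<Rightarrow> bool" where
  "tested_along a g f n c \<longleftrightarrow> c \<noteq> 0 \<and>
    (\<forall>i. convergent (\<lambda>j. g i (n j))) \<and> (\<forall>m. convergent (\<lambda>j. a (n j) m)) \<and>
    (\<forall>j. \<bar>(\<Sum>m. a (n j) m * f m) - c * sign_pattern j\<bar> \<le> \<bar>c\<bar> / 8)"

text \<open>A diagonal extraction makes the masses of all cones converge. \<open>\<Phi>\<close>
  consists of the atoms of the limit; off \<open>\<Phi>\<close> some cone around the branch has
  arbitrarily small limit mass, so the row sums are approximated by finite sums over converging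
  columns.\<close>

lemma node_subsequence:
  assumes adm: "admissible a g"
  shows "\<exists>\<Phi> r c. countable \<Phi> \<and> strict_mono r \<and> c \<noteq> 0 \<and> (\<lambda>j. a (node x (r j)) (node x (r j))) \<longlonglongrightarrow> c \<and>
    (\<forall>i. convergent (\<lambda>j. g i (node x (r j)))) \<and> (\<forall>m. convergent (\<lambda>j. a (node x (r j)) m)) \<and>
    (\<forall>y h. y \<notin> \<Phi> \<longrightarrow> (\<forall>m. \<bar>h m\<bar> \<le> 1) \<longrightarrow> (\<forall>m. m \<notin> range (node y) \<longrightarrow> h m = 0) \<longrightarrow>
       convergent (\<lambda>j. \<Sum>m. a (node x (r j)) m * h m))"
proof -
  obtain M \<delta> where summ: "\<And>k. summable (\<lambda>m. \<bar>a k m\<bar>)" and bound: "\<And>k. (\<Sum>m. \<bar>a k m\<bar>) \<le> M"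
    and \<delta>: "\<delta> > 0" "\<And>k. \<delta> \<le> \<bar>a k k\<bar>" and g: "\<And>i. Bseq (g i)"
    using adm unfolding admissible_def by blast
  have entry: "\<bar>a k m\<bar> \<le> M" for k m
    using sum_le_suminf[OF summ[of k], of "{m}"] bound[of k] by simp
  have mass_le: "mass (a k) (node_cone J c) \<le> M" for k J c
    using sum_mass_cones_le[OF summ[of k], of "{c}" J] bound[of k] by simp
  define H where "H = range (\<lambda>i j. g i (node x j)) \<union> range (\<lambda>m j. a (node x j) m)
    \<union> {\<lambda>j. a (node x j) (node x j)} \<union> range (\<lambda>(J, c) j. mass (a (node x j)) (node_cone J c))"
  have "\<exists>r. strict_mono r \<and> (\<forall>h\<in>H. convergent (\<lambda>j. h (r j)))"
  proof (rule common_convergent_subsequence)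
    show "countable H" by (simp add: H_def)
    have "Bseq (\<lambda>j. g i (node x j))" for i using g[of i] by (auto simp: Bseq_def)
    moreover have "Bseq (\<lambda>j. a (node x j) m)" "Bseq (\<lambda>j. a (node x j) (node x j))" for m
      by (rule BseqI'[of _ M], simp add: entry)+
    moreover have "Bseq (\<lambda>j. mass (a (node x j)) (node_cone J c))" for J c
      using mass_nonneg[OF summ] by (intro BseqI'[of _ M]) (simp add: mass_le)
    ultimately show "Bseq h" if "h \<in> H" for h using that by (auto simp: H_def)
  qed
  then obtain r where r: "strict_mono r" and conv: "\<And>h. h \<in> H \<Longrightarrow> convergent (\<lambda>j. h (r j))" by blast
  let ?n = "\<lambda>j. node x (r j)"
  have cg: "convergent (\<lambda>j. g i (?n j))" and ca: "convergent (\<lambda>j. a (?n j) m)"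
    and cd: "convergent (\<lambda>j. a (?n j) (?n j))" for i m
    using conv[of "\<lambda>j. g i (node x j)"] conv[of "\<lambda>j. a (node x j) m"]
      conv[of "\<lambda>j. a (node x j) (node x j)"] by (auto simp: H_def)
  have cm: "convergent (\<lambda>j. mass (a (?n j)) (node_cone J c))" for J c
  proof -
    have "(\<lambda>j. mass (a (node x j)) (node_cone J c)) \<in> H" unfolding H_def by (auto intro!: image_eqI[of _ _ "(J, c)"])
    from conv[OF this] show ?thesis .
  qed
  obtain c where c: "(\<lambda>j. a (?n j) (?n j)) \<longlonglongrightarrow> c" using cd unfolding convergent_def by blast
  have "\<delta> \<le> \<bar>c\<bar>"
    using \<delta>(2) by (intro LIMSEQ_le_const[OF tendsto_rabs[OF c]]) auto
  define l where "l J c = lim (\<lambda>j. mass (a (?n j)) (node_cone J c))" for J c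
  have l: "(\<lambda>j. mass (a (?n j)) (node_cone J c)) \<longlonglongrightarrow> l J c" for J c
    unfolding l_def using cm by (simp add: convergent_LIMSEQ_iff)
  define \<Phi> where "\<Phi> = {y. \<exists>e>0. \<forall>J. e \<le> l J (node y J)}"
  have "countable \<Phi>"
    unfolding \<Phi>_def
  proof (rule countable_atoms)
    fix J and S :: "nat set" assume "finite S"
    have "(\<lambda>j. \<Sum>c\<in>S. mass (a (?n j)) (node_cone J c)) \<longlonglongrightarrow> (\<Sum>c\<in>S. l J c)" by (intro tendsto_sum l)
    moreover have "(\<Sum>c\<in>S. mass (a (?n j)) (node_cone J c)) \<le> M" for j
      using sum_mass_cones_le[OF summ \<open>finite S\<close>, of "?n j" J] bound[of "?n j"] by linarith
    ultimately show "(\<Sum>c\<in>S. l J c) \<le> M" by (intro LIMSEQ_le_const2) auto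
  qed
  moreover have "convergent (\<lambda>j. \<Sum>m. a (?n j) m * h m)"
    if y: "y \<notin> \<Phi>" and h: "\<And>m. \<bar>h m\<bar> \<le> 1" "\<And>m. m \<notin> range (node y) \<Longrightarrow> h m = 0" for y and h :: "nat \<Rightarrow> real"
  proof (rule convergent_if_approximable)
    fix e :: real assume "e > 0"
    then obtain J where "l J (node y J) < e" using y by (auto simp: \<Phi>_def not_le)
    then have ev: "\<forall>\<^sub>F j in sequentially. mass (a (?n j)) (node_cone J (node y J)) < e"
      using order_tendstoD(2)[OF l] by blast
    show "\<exists>v. convergent v \<and> (\<forall>\<^sub>F j in sequentially. \<bar>(\<Sum>m. a (?n j) m * h m) - v j\<bar> < e)"
    proof (intro exI conjI)
      show "convergent (\<lambda>j. \<Sum>m\<in>node y ` {..<J}. a (?n j) m * h m)"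
        by (intro convergent_sum convergent_mult ca convergent_const)
      show "\<forall>\<^sub>F j in sequentially.
          \<bar>(\<Sum>m. a (?n j) m * h m) - (\<Sum>m\<in>node y ` {..<J}. a (?n j) m * h m)\<bar> < e"
      proof (rule eventually_mono[OF ev])
        fix j assume "mass (a (?n j)) (node_cone J (node y J)) < e"
        then show "\<bar>(\<Sum>m. a (?n j) m * h m) - (\<Sum>m\<in>node y ` {..<J}. a (?n j) m * h m)\<bar> < e"
          using branch_sum_approx[of "a (?n j)" h y J, OF summ h] by simp
      qed
    qed
  qed
  ultimately show ?thesis
    using r c \<open>\<delta> \<le> \<bar>c\<bar>\<close> \<delta>(1) cg ca
    by (intro exI[of _ \<Phi>] exI[of _ r] exI[of _ c]) auto
qed

text \<open>The functions \<open>e y\<close> are those already constructed, one per branch. Off the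
  atoms their row sums converge automatically; the countably many on atoms are handled by a further
  extraction, before the new function is built on what remains.\<close>

lemma tested_branch_function:
  fixes e :: "real \<Rightarrow> nat \<Rightarrow> real"
  assumes adm: "admissible a g" and e: "\<And>y m. \<bar>e y m\<bar> \<le> 1"
    and supp: "\<And>y m. m \<notin> range (node y) \<Longrightarrow> e y m = 0"
  shows "\<exists>\<Phi> n f c. countable \<Phi> \<and> inj n \<and> range n \<subseteq> range (node x) \<and>
    (\<forall>j. f (n j) = sign_pattern j) \<and> (\<forall>m. m \<notin> range n \<longrightarrow> f m = 0) \<and> tested_along a g f n c \<and>
    (\<forall>y. convergent (\<lambda>j. \<Sum>m. a (n j) m * e y m)) \<and>
    (\<forall>y h. y \<notin> \<Phi> \<longrightarrow> (\<forall>m. \<bar>h m\<bar> \<le> 1) \<longrightarrow> (\<forall>m. m \<notin> range (node y) \<longrightarrow> h m = 0) \<longrightarrow>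
       convergent (\<lambda>j. \<Sum>m. a (n j) m * h m))"
proof -
  obtain M where summ: "\<And>k. summable (\<lambda>m. \<bar>a k m\<bar>)" and bound: "\<And>k. (\<Sum>m. \<bar>a k m\<bar>) \<le> M"
    using adm unfolding admissible_def by blast
  obtain \<Phi> r c where \<Phi>: "countable \<Phi>" and r: "strict_mono r" and c: "c \<noteq> 0"
    and diag: "(\<lambda>j. a (node x (r j)) (node x (r j))) \<longlonglongrightarrow> c"
    and cg: "\<And>i. convergent (\<lambda>j. g i (node x (r j)))"
    and ca: "\<And>m. convergent (\<lambda>j. a (node x (r j)) m)"
    and off: "\<And>y h. y \<notin> \<Phi> \<Longrightarrow> (\<And>m. \<bar>h m\<bar> \<le> 1) \<Longrightarrow> (\<And>m. m \<notin> range (node y) \<Longrightarrow> h m = 0) \<Longrightarrow>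
       convergent (\<lambda>j. \<Sum>m. a (node x (r j)) m * h m)"
    using node_subsequence[OF adm, of x] by blast
  have "\<exists>r'. strict_mono r' \<and>
      (\<forall>h\<in>(\<lambda>y j. \<Sum>m. a (node x (r j)) m * e y m) ` \<Phi>. convergent (\<lambda>j. h (r' j)))"
  proof (rule common_convergent_subsequence)
    fix h assume "h \<in> (\<lambda>y j. \<Sum>m. a (node x (r j)) m * e y m) ` \<Phi>"
    then obtain y where "h = (\<lambda>j. \<Sum>m. a (node x (r j)) m * e y m)" by blast
    moreover have "\<bar>\<Sum>m. a (node x (r j)) m * e y m\<bar> \<le> M" for j y
      using abs_suminf_mult_le[of "a (node x (r j))" "e y", OF summ e] bound[of "node x (r j)"] by linarith
    ultimately show "Bseq h" by (intro BseqI'[of _ M]) simp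
  qed (use \<Phi> in simp)
  then obtain r' where r': "strict_mono r'"
    and on: "\<And>y. y \<in> \<Phi> \<Longrightarrow> convergent (\<lambda>j. \<Sum>m. a (node x (r (r' j))) m * e y m)"
    by auto
  define k where "k j = node x (r (r' j))" for j
  have sub: "convergent (\<lambda>j. u (s j))" if "convergent u" "strict_mono s" for u :: "nat \<Rightarrow> real" and s
    using convergent_subseq_convergent[OF that] by (simp add: o_def)
  have inj: "inj k"
    using r r' by (auto simp: inj_def k_def node_eq_iff strict_mono_eq)
  have "convergent (\<lambda>j. a (k j) m)" for m unfolding k_def using sub[OF ca r'] .
  moreover have "(\<lambda>j. a (k j) (k j)) \<longlonglongrightarrow> c"
    using LIMSEQ_subseq_LIMSEQ[OF diag r'] by (simp add: k_def o_def)
  ultimately obtain t f where t: "strict_mono t" and f: "\<And>j. f (k (t j)) = sign_pattern j"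
    "\<And>m. m \<notin> range (\<lambda>j. k (t j)) \<Longrightarrow> f m = 0"
    "\<And>j. \<bar>(\<Sum>m. a (k (t j)) m * f m) - c * sign_pattern j\<bar> \<le> \<bar>c\<bar> / 8"
    using branch_function[of k a M c, OF inj summ bound] c unfolding o_def by blast
  have off': "convergent (\<lambda>j. \<Sum>m. a (k (t j)) m * h m)"
    if "y \<notin> \<Phi>" "\<And>m. \<bar>h m\<bar> \<le> 1" "\<And>m. m \<notin> range (node y) \<Longrightarrow> h m = 0" for y h
    unfolding k_def using sub[OF sub[OF off[OF that] r'] t] .
  have "tested_along a g f (k \<circ> t) c"
    unfolding tested_along_def k_def o_def
    using c sub[OF sub[OF cg r'] t] sub[OF sub[OF ca r'] t] f(3) by (simp add: k_def)
  moreover have "convergent (\<lambda>j. \<Sum>m. a (k (t j)) m * e y m)" for y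
  proof (cases "y \<in> \<Phi>")
    case True
    then show ?thesis unfolding k_def using sub[OF on t] by blast
  qed (use off' e supp in blast)
  moreover have "inj (k \<circ> t)" using inj strict_mono_imp_inj_on[OF t] by (simp add: inj_compose)
  moreover have "range (k \<circ> t) \<subseteq> range (node x)" by (auto simp: k_def)
  ultimately show ?thesis
    using \<Phi> f(1,2) off' by (intro exI[of _ \<Phi>] exI[of _ "k \<circ> t"] exI[of _ f] exI[of _ c]) (simp add: o_def)
qed

section \<open>The almost disjoint family\<close>

locale signed_almost_disjoint_family =
  fixes f :: "real \<Rightarrow> nat \<Rightarrow> real"
  assumes vals: "f p n \<in> {- 1, 0, 1}"
    and supp_infinite: "infinite {n. f p n \<noteq> 0}"
    and almost_disjoint: "p \<noteq> q \<Longrightarrow> finite {n. f p n \<noteq> 0 \<and> f q n \<noteq> 0}"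

definition tests :: "(real \<Rightarrow> nat \<Rightarrow> real) \<Rightarrow> real \<Rightarrow> (nat \<Rightarrow> nat \<Rightarrow> real) \<Rightarrow> (nat \<Rightarrow> nat \<Rightarrow> real) \<Rightarrow> bool" where
  "tests f p a g \<longleftrightarrow> (\<exists>n c. tested_along a g (f p) n c \<and>
    (\<forall>q. q \<noteq> p \<longrightarrow> convergent (\<lambda>j. \<Sum>m. a (n j) m * f q m)))"

text \<open>At stage \<open>p\<close> convergence for the earlier functions is arranged by the
  choice of the test sequence; for the later ones it follows since their branches avoid the atoms of
  stage \<open>p\<close>.\<close>

theorem testing_family_exists:
  "\<exists>f. signed_almost_disjoint_family f \<and> (\<forall>a g. admissible a g \<longrightarrow> uncountable {p. tests f p a g})"
proof -
  obtain d :: "real \<Rightarrow> (nat \<Rightarrow> nat \<Rightarrow> real) \<times> (nat \<Rightarrow> nat \<Rightarrow> real)"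
    where d: "\<And>c. uncountable {p. d p = c}" using real_codes_parameters by blast
  define r where "r = card_of (UNIV :: real set)"
  have r: "well_order_on UNIV r" unfolding r_def by (rule card_of_well_order_on)
  have comparable: "p \<in> underS r q \<or> q \<in> underS r p" if "p \<noteq> q" for p q
    using r that by (auto simp: well_order_on_def linear_order_on_def total_on_def underS_def)
  \<comment> \<open>The recursion chooses triples: a branch, the set of branches that are atoms of the limit
    measure, and the function.\<close>
  define loc :: "real \<times> real set \<times> (nat \<Rightarrow> real) \<Rightarrow> real" where "loc = fst"
  define atoms :: "real \<times> real set \<times> (nat \<Rightarrow> real) \<Rightarrow> real set" where "atoms = (\<lambda>v. fst (snd v))"
  define fn :: "real \<times> real set \<times> (nat \<Rightarrow> real) \<Rightarrow> nat \<Rightarrow> real" where "fn = (\<lambda>v. snd (snd v))"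
  have sel: "loc (x, \<Phi>, h) = x" "atoms (x, \<Phi>, h) = \<Phi>" "fn (x, \<Phi>, h) = h" for x \<Phi> h
    by (simp_all add: loc_def atoms_def fn_def)
  define off where "off a n \<Phi> \<longleftrightarrow> (\<forall>y h. y \<notin> \<Phi> \<longrightarrow> (\<forall>m. \<bar>h m\<bar> \<le> 1) \<longrightarrow>
      (\<forall>m. m \<notin> range (node y) \<longrightarrow> h m = 0) \<longrightarrow> convergent (\<lambda>j. \<Sum>m. a (n j) m * h m))"
    for a :: "nat \<Rightarrow> nat \<Rightarrow> real" and n :: "nat \<Rightarrow> nat" and \<Phi> :: "real set"
  define P1 where "P1 F p v \<longleftrightarrow> countable (atoms v) \<and> (\<forall>m. fn v m \<in> {- 1, 0, 1}) \<and>
      infinite {m. fn v m \<noteq> 0} \<and> (\<forall>m. m \<notin> range (node (loc v)) \<longrightarrow> fn v m = 0) \<and>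
      (\<forall>q\<in>underS r p. loc v \<notin> insert (loc (F q)) (atoms (F q)))"
    for F :: "real \<Rightarrow> real \<times> real set \<times> (nat \<Rightarrow> real)" and p v
  define P2 where "P2 F p v \<longleftrightarrow> admissible (fst (d p)) (snd (d p)) \<longrightarrow>
      (\<exists>n c. tested_along (fst (d p)) (snd (d p)) (fn v) n c \<and>
        (\<forall>q\<in>underS r p. convergent (\<lambda>j. \<Sum>m. fst (d p) (n j) m * fn (F q) m)) \<and>
        off (fst (d p)) n (atoms v))"
    for F :: "real \<Rightarrow> real \<times> real set \<times> (nat \<Rightarrow> real)" and p v
  define P where "P F p v \<longleftrightarrow> P1 F p v \<and> P2 F p v" for F p v
  have P1: "countable (atoms v)" "fn v m \<in> {- 1, 0, 1}" "infinite {m. fn v m \<noteq> 0}"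
    "m \<notin> range (node (loc v)) \<Longrightarrow> fn v m = 0"
    "q \<in> underS r p \<Longrightarrow> loc v \<noteq> loc (F q)" "q \<in> underS r p \<Longrightarrow> loc v \<notin> atoms (F q)"
    if "P F p v" for F p v m q
    using that unfolding P_def P1_def by simp_all
  have "\<exists>F. \<forall>p. P F p (F p)"
  proof (rule dependent_wf_choice)
    show "wf (r - Id)" using r by (simp add: well_order_on_def)
    show "P F p v = P G p v" if eq: "\<And>q. (q, p) \<in> r - Id \<Longrightarrow> F q = G q" for F G p v
    proof -
      have "F q = G q" if "q \<in> underS r p" for q using eq[of q] that by (auto simp: underS_def)
      then show ?thesis unfolding P_def P1_def P2_def by simp
    qed
    fix F p assume "\<And>q. (q, p) \<in> r - Id \<Longrightarrow> P F q (F q)"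
    then have IH: "P F q (F q)" if "q \<in> underS r p" for q using that by (auto simp: underS_def)
    let ?U = "underS r p" and ?a = "fst (d p)" and ?g = "snd (d p)"
    \<comment> \<open>The conditional makes the set countable for every \<open>q\<close>, as the
      lemma on small unions demands, while the induction hypothesis speaks only of \<open>q\<close>
      below \<open>p\<close>.\<close>
    have "\<exists>x. x \<notin> (\<Union>q\<in>?U. if q \<in> ?U then insert (loc (F q)) (atoms (F q)) else {})"
      unfolding r_def by (rule ex_outside_small_union) (simp add: P1(1)[OF IH] r_def[symmetric])
    then obtain x where x: "\<And>q. q \<in> ?U \<Longrightarrow> x \<notin> insert (loc (F q)) (atoms (F q))" by auto
    show "\<exists>v. P F p v"
    proof (cases "admissible ?a ?g")
      case False
      have "{m. of_bool (m \<in> range (node x)) \<noteq> (0 :: real)} = range (node x)" by auto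
      then have "infinite {m. of_bool (m \<in> range (node x)) \<noteq> (0 :: real)}"
        using finite_imageD[OF _ inj_node[of x]] by auto
      \<comment> \<open>A code that is not admissible imposes no test, so the indicator of the whole
        branch with no atoms will do.\<close>
      then have "P F p (x, {}, \<lambda>m. of_bool (m \<in> range (node x)))"
        using False x unfolding P_def P1_def P2_def sel by simp
      then show ?thesis ..
    next
      case True
      have inj: "inj_on (\<lambda>q. loc (F q)) ?U"
      proof (rule inj_onI, rule ccontr)
        fix q q' assume q: "q \<in> ?U" "q' \<in> ?U" "loc (F q) = loc (F q')" "q \<noteq> q'"
        then show False
          using comparable[OF q(4)] P1(5)[OF IH[OF q(1)], of q'] P1(5)[OF IH[OF q(2)], of q] by auto
      qed
      \<comment> \<open>The earlier functions are reindexed by their branches, which are distinct;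
        branches not yet in use receive the zero function.\<close>
      define e where "e y m = (if y \<in> (\<lambda>q. loc (F q)) ` ?U
        then fn (F (inv_into ?U (\<lambda>q. loc (F q)) y)) m else 0)" for y m
      have e_loc: "e (loc (F q)) = fn (F q)" if "q \<in> ?U" for q
        using that inv_into_f_f[OF inj that] by (auto simp: e_def fun_eq_iff)
      have e: "\<bar>e y m\<bar> \<le> 1" "m \<notin> range (node y) \<Longrightarrow> e y m = 0" for y m
      proof -
        have "\<bar>e y m\<bar> \<le> 1 \<and> (m \<notin> range (node y) \<longrightarrow> e y m = 0)"
        proof (cases "y \<in> (\<lambda>q. loc (F q)) ` ?U")
          case True
          then obtain q where q: "q \<in> ?U" "y = loc (F q)" by blast
          have "fn (F q) m \<in> {- 1, 0, 1}" "m \<notin> range (node y) \<longrightarrow> fn (F q) m = 0"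
            using P1(2,4)[OF IH[OF q(1)]] unfolding q(2) by blast+
          then show ?thesis using e_loc[OF q(1)] unfolding q(2) by auto
        qed (simp add: e_def)
        then show "\<bar>e y m\<bar> \<le> 1" "m \<notin> range (node y) \<Longrightarrow> e y m = 0" by auto
      qed
      obtain \<Phi> n f c where \<Phi>: "countable \<Phi>" and n: "inj n" "range n \<subseteq> range (node x)"
        and f: "\<And>j. f (n j) = sign_pattern j" "\<And>m. m \<notin> range n \<Longrightarrow> f m = 0"
        and tested: "tested_along ?a ?g f n c"
        and on: "\<And>y. convergent (\<lambda>j. \<Sum>m. ?a (n j) m * e y m)" and "off ?a n \<Phi>"
        using tested_branch_function[of ?a ?g e x, OF True e] unfolding off_def by blast
      have "f m \<in> {- 1, 0, 1}" for m
      proof (cases "m \<in> range n")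
        case True
        then obtain j where "m = n j" by blast
        then show ?thesis using f(1)[of j] sign_pattern_mem[of j] by simp
      qed (simp add: f(2))
      moreover have "infinite {m. f m \<noteq> 0}"
      proof -
        have "inj (\<lambda>j. n (3 * j))"
        proof (rule injI)
          fix i j assume "n (3 * i) = n (3 * j)"
          then have "3 * i = 3 * j" by (rule injD[OF n(1)])
          then show "i = j" by simp
        qed
        then have "infinite (range (\<lambda>j. n (3 * j)))" by (rule range_inj_infinite)
        moreover have "range (\<lambda>j. n (3 * j)) \<subseteq> {m. f m \<noteq> 0}"
          using f(1) by (auto simp: sign_pattern_def)
        ultimately show ?thesis using infinite_super by blast
      qed
      moreover have "convergent (\<lambda>j. \<Sum>m. ?a (n j) m * fn (F q) m)" if "q \<in> ?U" for q
        using on[of "loc (F q)"] e_loc[OF that] by simp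
      then have "\<exists>n c. tested_along ?a ?g f n c \<and>
          (\<forall>q\<in>?U. convergent (\<lambda>j. \<Sum>m. ?a (n j) m * fn (F q) m)) \<and> off ?a n \<Phi>"
        using tested \<open>off ?a n \<Phi>\<close> by blast
      moreover have "\<forall>m. m \<notin> range (node x) \<longrightarrow> f m = 0" using f(2) n(2) by blast
      ultimately have "P F p (x, \<Phi>, f)"
        using \<Phi> x unfolding P_def P1_def P2_def sel by simp
      then show ?thesis ..
    qed
  qed
  then obtain F where F: "\<And>p. P F p (F p)" by blast
  define f where "f p = fn (F p)" for p
  have vals: "f p m \<in> {- 1, 0, 1}" and supp: "m \<notin> range (node (loc (F p))) \<Longrightarrow> f p m = 0" for p m
    using P1(2,4)[OF F[of p]] unfolding f_def by blast+
  have loc: "loc (F p) \<noteq> loc (F q)" if "p \<noteq> q" for p q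
    using comparable[OF that] P1(5)[OF F[of p], of q] P1(5)[OF F[of q], of p] by auto
  have "signed_almost_disjoint_family f"
  proof
    show "f p m \<in> {- 1, 0, 1}" for p m by (rule vals)
    show "infinite {m. f p m \<noteq> 0}" for p using P1(3)[OF F[of p]] unfolding f_def .
    show "finite {m. f p m \<noteq> 0 \<and> f q m \<noteq> 0}" if "p \<noteq> q" for p q
      by (rule finite_subset[OF _ branches_almost_disjoint[OF loc[OF that]]]) (use supp in blast)
  qed
  moreover have "uncountable {p. tests f p a g}"
    if adm: "admissible a g" for a g
  proof -
    have "{p. d p = (a, g)} \<subseteq> {p. tests f p a g}"
    proof clarify
      fix p assume "d p = (a, g)"
      then obtain n c where nc: "tested_along a g (f p) n c" "off a n (atoms (F p))"
        "\<And>q. q \<in> underS r p \<Longrightarrow> convergent (\<lambda>j. \<Sum>m. a (n j) m * f q m)"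
        using F[of p] adm unfolding P_def P2_def f_def by auto
      have "convergent (\<lambda>j. \<Sum>m. a (n j) m * f q m)" if "q \<noteq> p" for q
      proof (cases "q \<in> underS r p")
        case False
        then have "loc (F q) \<notin> atoms (F p)"
          using comparable[OF that] P1(6)[OF F[of q], of p] by blast
        moreover have "\<bar>f q m\<bar> \<le> 1" for m using vals[of q m] by auto
        ultimately show ?thesis using nc(2) supp[of _ q] unfolding off_def by blast
      qed (rule nc(3))
      then show "tests f p a g" unfolding tests_def using nc(1) by blast
    qed
    then show ?thesis using d countable_subset by blast
  qed
  ultimately show ?thesis by blast
qed

section \<open>The twisted sum\<close>

lemma vset_c0_nat_iff: "x \<in> vset (c0_space (UNIV :: nat set)) \<longleftrightarrow> x \<longlonglongrightarrow> 0"
  unfolding c0_space_def sup_normed_space_def tendsto_iff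
  by (simp add: cofinite_eq_sequentially[symmetric] eventually_cofinite not_less)

context signed_almost_disjoint_family
begin

definition comb :: "real set \<Rightarrow> (real \<Rightarrow> real) \<Rightarrow> nat \<Rightarrow> real" where
  "comb Q t n = (\<Sum>q\<in>Q. t q * f q n)"

text \<open>The closed linear span of \<open>c_0\<close> and the \<open>f p\<close> among bounded
  sequences: demanding closeness only for large \<open>n\<close> absorbs the \<open>c_0\<close>
  part.\<close>

definition twisted :: "(nat \<Rightarrow> real) set" where
  "twisted = {x. \<forall>e>0. \<exists>Q t. finite Q \<and> (\<forall>\<^sub>F n in sequentially. \<bar>x n - comb Q t n\<bar> < e)}"

definition twisted_space :: "(nat \<Rightarrow> real) normed_struct" where
  "twisted_space = sup_normed_space UNIV twisted"

definition supp_enum :: "real \<Rightarrow> nat \<Rightarrow> nat" where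
  "supp_enum p = enumerate {n. f p n \<noteq> 0}"

text \<open>On the support of \<open>f p\<close> the square of \<open>f p\<close> is 1, so the
  factor \<open>f p\<close> cancels the signs and the limit reads off the coefficient of
  \<open>f p\<close>. The limit exists for \<open>x\<close> in \<open>twisted\<close>, by
  \<open>coef_tendsto\<close>.\<close>

definition coef :: "(nat \<Rightarrow> real) \<Rightarrow> real \<Rightarrow> real" where
  "coef x p = lim (\<lambda>j. x (supp_enum p j) * f p (supp_enum p j))"

lemma abs_f_le: "\<bar>f p n\<bar> \<le> 1"
  using vals[of p n] by auto

lemma abs_mult_f_le: "\<bar>a * f p n\<bar> \<le> \<bar>a\<bar>"
  using mult_left_mono[OF abs_f_le[of p n], of "\<bar>a\<bar>"] by (simp add: abs_mult)

lemma f_square: "f p n \<noteq> 0 \<Longrightarrow> f p n * f p n = 1"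
  using vals[of p n] by auto

lemma supp_enum: "f p (supp_enum p j) \<noteq> 0" "strict_mono (supp_enum p)"
  using enumerate_in_set[OF supp_infinite[of p], of j] strict_mono_enumerate[OF supp_infinite[of p]]
  by (auto simp: supp_enum_def)

lemma eventually_supp_enum:
  assumes "\<forall>\<^sub>F n in sequentially. f p n \<noteq> 0 \<longrightarrow> R n"
  shows "\<forall>\<^sub>F j in sequentially. R (supp_enum p j)"
  using eventually_subseq[OF supp_enum(2)[of p] assms] supp_enum(1)[of p] by simp

lemma comb_on_supp:
  assumes Q: "finite Q"
  shows "\<forall>\<^sub>F n in sequentially. f p n \<noteq> 0 \<longrightarrow> comb Q t n = (if p \<in> Q then t p else 0) * f p n"
proof -
  have "\<forall>\<^sub>F n in sequentially. \<forall>q\<in>Q - {p}. \<not> (f p n \<noteq> 0 \<and> f q n \<noteq> 0)"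
  proof (intro eventually_ball_finite ballI)
    fix q assume "q \<in> Q - {p}"
    then have "finite {n. f p n \<noteq> 0 \<and> f q n \<noteq> 0}" using almost_disjoint[of p q] by blast
    then show "\<forall>\<^sub>F n in sequentially. \<not> (f p n \<noteq> 0 \<and> f q n \<noteq> 0)"
      unfolding cofinite_eq_sequentially[symmetric] eventually_cofinite by simp
  qed (use Q in simp)
  then show ?thesis
  proof (rule eventually_mono, intro impI)
    fix n assume n: "\<forall>q\<in>Q - {p}. \<not> (f p n \<noteq> 0 \<and> f q n \<noteq> 0)" "f p n \<noteq> 0"
    have "comb Q t n = (\<Sum>q\<in>Q. if q = p then t p * f p n else 0)"
      unfolding comb_def using n by (intro sum.cong) auto
    then show "comb Q t n = (if p \<in> Q then t p else 0) * f p n" using Q by simp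
  qed
qed

text \<open>Far out the supports of the members of \<open>Q\<close> are disjoint, so a combination
  is controlled there by its largest coefficient instead of the sum of all of them.\<close>

lemma comb_eq_or_zero:
  assumes Q: "finite Q"
  shows "\<forall>\<^sub>F n in sequentially.
    (\<forall>p\<in>Q. f p n \<noteq> 0 \<longrightarrow> comb Q t n = t p * f p n) \<and> ((\<forall>p\<in>Q. f p n = 0) \<longrightarrow> comb Q t n = 0)"
proof -
  have "\<forall>\<^sub>F n in sequentially. \<forall>p\<in>Q. f p n \<noteq> 0 \<longrightarrow> comb Q t n = t p * f p n"
    using Q
  proof (intro eventually_ball_finite ballI)
    fix p assume "p \<in> Q"
    then show "\<forall>\<^sub>F n in sequentially. f p n \<noteq> 0 \<longrightarrow> comb Q t n = t p * f p n"
      using comb_on_supp[OF Q, of p t] by simp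
  qed
  then show ?thesis by (rule eventually_mono) (simp add: comb_def)
qed

lemma comb_extend:
  assumes "Q \<subseteq> Q'" "finite Q'"
  shows "comb Q t = comb Q' (\<lambda>q. if q \<in> Q then t q else 0)"
proof
  fix n
  have "comb Q' (\<lambda>q. if q \<in> Q then t q else 0) n = (\<Sum>q\<in>Q'. if q \<in> Q then t q * f q n else 0)"
    unfolding comb_def by (intro sum.cong) auto
  also have "\<dots> = comb Q t n"
    using assms by (simp add: sum.If_cases comb_def Int_absorb1)
  finally show "comb Q t n = comb Q' (\<lambda>q. if q \<in> Q then t q else 0) n" ..
qed

section \<open>The twisted sum as a Banach space\<close>

lemma twistedE:
  assumes "x \<in> twisted" "e > 0"
  obtains Q t where "finite Q" "\<forall>\<^sub>F n in sequentially. \<bar>x n - comb Q t n\<bar> < e"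
  using assms unfolding twisted_def by blast

lemma twisted_add:
  assumes "x \<in> twisted" "y \<in> twisted"
  shows "(\<lambda>n. x n + y n) \<in> twisted"
  unfolding twisted_def
proof (clarify)
  fix e :: real assume "e > 0"
  then have e: "e / 2 > 0" by simp
  obtain Q t where Q: "finite Q" "\<forall>\<^sub>F n in sequentially. \<bar>x n - comb Q t n\<bar> < e / 2"
    using twistedE[OF assms(1) e] .
  obtain R u where R: "finite R" "\<forall>\<^sub>F n in sequentially. \<bar>y n - comb R u n\<bar> < e / 2"
    using twistedE[OF assms(2) e] .
  let ?t = "\<lambda>q. (if q \<in> Q then t q else 0) + (if q \<in> R then u q else 0)"
  have eq: "comb (Q \<union> R) ?t n = comb Q t n + comb R u n" for n
    using comb_extend[of Q "Q \<union> R" t] comb_extend[of R "Q \<union> R" u] Q(1) R(1)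
    by (simp add: comb_def sum.distrib distrib_right)
  have "\<forall>\<^sub>F n in sequentially. \<bar>x n + y n - comb (Q \<union> R) ?t n\<bar> < e"
    using Q(2) R(2) by eventually_elim (unfold eq, linarith)
  then show "\<exists>Q t. finite Q \<and> (\<forall>\<^sub>F n in sequentially. \<bar>x n + y n - comb Q t n\<bar> < e)"
    using Q(1) R(1) by blast
qed

lemma twisted_scale:
  assumes "x \<in> twisted"
  shows "(\<lambda>n. a * x n) \<in> twisted"
  unfolding twisted_def
proof (clarify)
  fix e :: real assume "e > 0"
  then have e: "e / (\<bar>a\<bar> + 1) > 0" by simp
  obtain Q t where Q: "finite Q" "\<forall>\<^sub>F n in sequentially. \<bar>x n - comb Q t n\<bar> < e / (\<bar>a\<bar> + 1)"
    using twistedE[OF assms e] .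
  have "comb Q (\<lambda>q. a * t q) n = a * comb Q t n" for n
    by (simp add: comb_def sum_distrib_left mult.assoc)
  then have eq: "\<bar>a * x n - comb Q (\<lambda>q. a * t q) n\<bar> = \<bar>a\<bar> * \<bar>x n - comb Q t n\<bar>" for n
    by (simp add: right_diff_distrib[symmetric] abs_mult)
  have "\<forall>\<^sub>F n in sequentially. \<bar>a * x n - comb Q (\<lambda>q. a * t q) n\<bar> < e"
    using Q(2)
  proof eventually_elim
    case (elim n)
    have "\<bar>a\<bar> * \<bar>x n - comb Q t n\<bar> \<le> \<bar>a\<bar> * (e / (\<bar>a\<bar> + 1))"
      using elim by (intro mult_left_mono) auto
    also have "\<dots> < e" using \<open>e > 0\<close> by (simp add: field_simps)
    finally show ?case unfolding eq .
  qed
  then show "\<exists>Q t. finite Q \<and> (\<forall>\<^sub>F n in sequentially. \<bar>a * x n - comb Q t n\<bar> < e)"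
    using Q(1) by blast
qed

lemma null_in_twisted:
  assumes "x \<longlonglongrightarrow> 0"
  shows "x \<in> twisted"
proof -
  have "\<exists>Q t. finite Q \<and> (\<forall>\<^sub>F n in sequentially. \<bar>x n - comb Q t n\<bar> < e)" if "e > 0" for e
    using tendstoD[OF assms that] by (intro exI[of _ "{}"]) (simp add: comb_def)
  then show ?thesis by (simp add: twisted_def)
qed

lemma f_in_twisted: "f p \<in> twisted"
proof -
  have "comb {p} (\<lambda>_. 1) = f p" by (auto simp: comb_def)
  then have "\<exists>Q t. finite Q \<and> (\<forall>\<^sub>F n in sequentially. \<bar>f p n - comb Q t n\<bar> < e)" if "e > 0" for e
    using that by (intro exI[of _ "{p}"] exI[of _ "\<lambda>_. 1"]) simp
  then show ?thesis by (simp add: twisted_def)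
qed

lemma abs_comb_le: "\<bar>comb Q t n\<bar> \<le> (\<Sum>q\<in>Q. \<bar>t q\<bar>)"
proof -
  have "\<bar>comb Q t n\<bar> \<le> (\<Sum>q\<in>Q. \<bar>t q * f q n\<bar>)" unfolding comb_def by (rule sum_abs)
  also have "\<dots> \<le> (\<Sum>q\<in>Q. \<bar>t q\<bar>)"
    by (intro sum_mono abs_mult_f_le)
  finally show ?thesis .
qed

lemma twisted_bounded:
  assumes "x \<in> twisted"
  shows "\<exists>B. \<forall>n. \<bar>x n\<bar> \<le> B"
proof -
  obtain Q t where Q: "finite Q" "\<forall>\<^sub>F n in sequentially. \<bar>x n - comb Q t n\<bar> < 1"
    using twistedE[OF assms zero_less_one] .
  have "\<forall>\<^sub>F n in sequentially. norm (x n) \<le> norm (1 + (\<Sum>q\<in>Q. \<bar>t q\<bar>))"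
    using Q(2)
  proof eventually_elim
    case (elim n)
    then show ?case using abs_comb_le[of Q t n] by (simp add: abs_if split: if_splits)
  qed
  then have "Bseq x" by (rule Bseq_eventually_mono) simp
  then show ?thesis by (auto simp: Bseq_def)
qed

lemma abs_le_norm: "x \<in> twisted \<Longrightarrow> \<bar>x n\<bar> \<le> sup_norm UNIV x"
  using twisted_bounded[of x] abs_le_sup_norm[of UNIV x] by blast

lemma banach_twisted_space: "banach_space twisted_space"
  unfolding twisted_space_def
proof (rule banach_space_sup_normed)
  show "(\<lambda>_. 0) \<in> twisted" by (rule null_in_twisted) simp
  show "\<exists>B. \<forall>n\<in>UNIV. \<bar>x n\<bar> \<le> B" if "x \<in> twisted" for x
    using twisted_bounded[OF that] by simp
  fix y assume y: "\<And>e. e > 0 \<Longrightarrow> \<exists>x\<in>twisted. \<forall>n\<in>UNIV. \<bar>x n - y n\<bar> < e"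
  have "\<exists>Q t. finite Q \<and> (\<forall>\<^sub>F n in sequentially. \<bar>y n - comb Q t n\<bar> < e)" if "e > 0" for e
  proof -
    have e: "e / 2 > 0" using that by simp
    obtain x where x: "x \<in> twisted" "\<And>n. \<bar>x n - y n\<bar> < e / 2" using y[OF e] by blast
    obtain Q t where Q: "finite Q" "\<forall>\<^sub>F n in sequentially. \<bar>x n - comb Q t n\<bar> < e / 2"
      using twistedE[OF x(1) e] .
    have "\<bar>y n - comb Q t n\<bar> < e" if "\<bar>x n - comb Q t n\<bar> < e / 2" for n
      using x(2)[of n] that by linarith
    then show ?thesis using Q by (blast intro: eventually_mono)
  qed
  then show "y \<in> twisted" by (simp add: twisted_def)
qed (use twisted_add twisted_scale in auto)

section \<open>The quotient map given by the coefficients\<close>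

lemma approx_on_supp:
  assumes Q: "finite Q" and ev: "\<forall>\<^sub>F n in sequentially. \<bar>x n - comb Q t n\<bar> < e"
  shows "\<forall>\<^sub>F j in sequentially.
    \<bar>x (supp_enum p j) * f p (supp_enum p j) - (if p \<in> Q then t p else 0)\<bar> < e"
proof (rule eventually_supp_enum)
  show "\<forall>\<^sub>F n in sequentially. f p n \<noteq> 0 \<longrightarrow> \<bar>x n * f p n - (if p \<in> Q then t p else 0)\<bar> < e"
    using ev comb_on_supp[OF Q, of p t]
  proof eventually_elim
    case (elim n)
    show ?case
    proof
      assume n: "f p n \<noteq> 0"
      have "(if p \<in> Q then t p else 0) = comb Q t n * f p n"
        using elim(2) n f_square[OF n] by simp
      then have "x n * f p n - (if p \<in> Q then t p else 0) = (x n - comb Q t n) * f p n"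
        by (simp add: left_diff_distrib)
      then show "\<bar>x n * f p n - (if p \<in> Q then t p else 0)\<bar> < e"
        using elim(1) abs_mult_f_le[of "x n - comb Q t n" p n] by linarith
    qed
  qed
qed

lemma coef_tendsto:
  assumes "x \<in> twisted"
  shows "(\<lambda>j. x (supp_enum p j) * f p (supp_enum p j)) \<longlonglongrightarrow> coef x p"
proof -
  have "convergent (\<lambda>j. x (supp_enum p j) * f p (supp_enum p j))"
  proof (rule convergent_if_approximable)
    fix e :: real assume "e > 0"
    then obtain Q t where Q: "finite Q" "\<forall>\<^sub>F n in sequentially. \<bar>x n - comb Q t n\<bar> < e"
      using twistedE[OF assms] by blast
    show "\<exists>v. convergent v \<and>
        (\<forall>\<^sub>F j in sequentially. \<bar>x (supp_enum p j) * f p (supp_enum p j) - v j\<bar> < e)"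
      using approx_on_supp[OF Q] convergent_const by blast
  qed
  then show ?thesis by (simp add: coef_def convergent_LIMSEQ_iff)
qed

text \<open>Passing to the limit along the support of \<open>f p\<close> compares
  \<open>coef x\<close> with the coefficients of any approximating combination; decay, kernel and
  range of \<open>coef\<close> are all obtained from this.\<close>

lemma coef_comb:
  assumes Q: "finite Q" and ev: "\<forall>\<^sub>F n in sequentially. \<bar>x n - comb Q t n\<bar> < e" and x: "x \<in> twisted"
  shows "\<bar>coef x p - (if p \<in> Q then t p else 0)\<bar> \<le> e"
proof (rule tendsto_upperbound)
  show "(\<lambda>j. \<bar>x (supp_enum p j) * f p (supp_enum p j) - (if p \<in> Q then t p else 0)\<bar>)
      \<longlonglongrightarrow> \<bar>coef x p - (if p \<in> Q then t p else 0)\<bar>"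
    by (intro tendsto_intros coef_tendsto x)
  show "\<forall>\<^sub>F j in sequentially.
      \<bar>x (supp_enum p j) * f p (supp_enum p j) - (if p \<in> Q then t p else 0)\<bar> \<le> e"
    using approx_on_supp[OF Q ev, of p] by (rule eventually_mono) simp
qed simp

lemma coef_add: "x \<in> twisted \<Longrightarrow> y \<in> twisted \<Longrightarrow> coef (\<lambda>n. x n + y n) p = coef x p + coef y p"
  using tendsto_add[OF coef_tendsto coef_tendsto, of x y p p]
  by (intro LIMSEQ_unique[OF coef_tendsto[OF twisted_add]]) (auto simp: distrib_right)

lemma coef_scale: "x \<in> twisted \<Longrightarrow> coef (\<lambda>n. a * x n) p = a * coef x p"
  using tendsto_mult_left[OF coef_tendsto, of x a p]
  by (intro LIMSEQ_unique[OF coef_tendsto[OF twisted_scale]]) (auto simp: mult.assoc)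

lemma abs_coef_le: "x \<in> twisted \<Longrightarrow> \<bar>coef x p\<bar> \<le> sup_norm UNIV x"
proof (rule LIMSEQ_le_const2[OF tendsto_rabs[OF coef_tendsto]])
  assume x: "x \<in> twisted"
  have "\<bar>x n * f p n\<bar> \<le> sup_norm UNIV x" for n
    using abs_le_norm[OF x, of n] abs_mult_f_le[of "x n" p n] by linarith
  then show "\<exists>N. \<forall>j\<ge>N. \<bar>x (supp_enum p j) * f p (supp_enum p j)\<bar> \<le> sup_norm UNIV x" by blast
qed

lemma coef_in_c0:
  assumes x: "x \<in> twisted"
  shows "coef x \<in> vset (c0_space UNIV)"
proof -
  have "finite {p. e \<le> \<bar>coef x p\<bar>}" if "e > 0" for e
  proof -
    have e: "e / 2 > 0" using that by simp
    obtain Q t where Q: "finite Q" "\<forall>\<^sub>F n in sequentially. \<bar>x n - comb Q t n\<bar> < e / 2"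
      using twistedE[OF x e] .
    have "{p. e \<le> \<bar>coef x p\<bar>} \<subseteq> Q"
    proof (rule subsetI, rule ccontr)
      fix p assume "p \<in> {p. e \<le> \<bar>coef x p\<bar>}" "p \<notin> Q"
      then show False using coef_comb[OF Q x, of p] \<open>e > 0\<close> by simp
    qed
    then show ?thesis using Q(1) finite_subset by blast
  qed
  then show ?thesis by (simp add: c0_space_def sup_normed_space_def)
qed

text \<open>If all coefficients vanish, every approximating combination has small coefficients and
  is therefore itself small far out. This is exactness in the middle.\<close>

lemma null_iff_coef_zero:
  assumes x: "x \<in> twisted"
  shows "x \<longlonglongrightarrow> 0 \<longleftrightarrow> coef x = (\<lambda>_. 0)"
proof
  assume x0: "x \<longlonglongrightarrow> 0"
  have "\<bar>coef x p\<bar> \<le> e" if "e > 0" for p e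
    using coef_comb[of "{}" x "\<lambda>_. 0" e p] tendstoD[OF x0 that] x by (simp add: comb_def)
  then have "\<bar>coef x p\<bar> \<le> 0" for p using field_le_epsilon[of "\<bar>coef x p\<bar>" 0] by simp
  then show "coef x = (\<lambda>_. 0)" by auto
next
  assume c: "coef x = (\<lambda>_. 0)"
  show "x \<longlonglongrightarrow> 0"
  proof (rule tendstoI)
    fix e :: real assume "e > 0"
    then have e: "e / 2 > 0" by simp
    obtain Q t where Q: "finite Q" "\<forall>\<^sub>F n in sequentially. \<bar>x n - comb Q t n\<bar> < e / 2"
      using twistedE[OF x e] .
    have t: "\<bar>t q\<bar> \<le> e / 2" if "q \<in> Q" for q
      using coef_comb[OF Q x, of q] c that by simp
    show "\<forall>\<^sub>F n in sequentially. dist (x n) 0 < e"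
      using Q(2) comb_eq_or_zero[OF Q(1), of t]
    proof eventually_elim
      case (elim n)
      have "\<bar>comb Q t n\<bar> \<le> e / 2"
      proof (cases "\<forall>q\<in>Q. f q n = 0")
        case False
        then obtain q where q: "q \<in> Q" "f q n \<noteq> 0" by blast
        then have "comb Q t n = t q * f q n" using elim(2) by blast
        then show ?thesis
          using t[OF q(1)] abs_mult_f_le[of "t q" q n] by linarith
      qed (use elim e in simp)
      then show ?case using elim(1) unfolding dist_real_def by linarith
    qed
  qed
qed

lemma coef_onto_c0:
  assumes t: "t \<in> vset (c0_space (UNIV :: real set))"
  shows "\<exists>x\<in>twisted. coef x = t"
proof -
  have fin: "finite {p. e \<le> \<bar>t p\<bar>}" if "e > 0" for e
    using t that by (simp add: c0_space_def sup_normed_space_def)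
  have ex: "\<exists>p. f p n \<noteq> 0 \<and> (\<forall>q. f q n \<noteq> 0 \<longrightarrow> \<bar>t q\<bar> \<le> \<bar>t p\<bar>)" if "f q n \<noteq> 0" for q n
  proof (cases "\<exists>q. f q n \<noteq> 0 \<and> t q \<noteq> 0")
    case True
    then obtain q' where q': "f q' n \<noteq> 0" "t q' \<noteq> 0" by blast
    \<comment> \<open>Since \<open>t q'\<close> is not 0, only finitely many members compete, so a
      largest coefficient exists.\<close>
    let ?A = "{p. \<bar>t q'\<bar> \<le> \<bar>t p\<bar> \<and> f p n \<noteq> 0}"
    have A: "finite ?A" "q' \<in> ?A" using fin[of "\<bar>t q'\<bar>"] q' by auto
    then have "Max ((\<lambda>r. \<bar>t r\<bar>) ` ?A) \<in> (\<lambda>r. \<bar>t r\<bar>) ` ?A" by (intro Max_in) auto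
    then obtain p where p: "p \<in> ?A" "Max ((\<lambda>r. \<bar>t r\<bar>) ` ?A) = \<bar>t p\<bar>" by blast
    have p_max: "\<bar>t r\<bar> \<le> \<bar>t p\<bar>" if "r \<in> ?A" for r
      using Max_ge[OF finite_imageI[OF A(1)] imageI[OF that], of "\<lambda>r. \<bar>t r\<bar>"] p(2) by simp
    have "\<bar>t r\<bar> \<le> \<bar>t p\<bar>" if "f r n \<noteq> 0" for r
      using p_max[of r] p(1) that by (cases "\<bar>t q'\<bar> \<le> \<bar>t r\<bar>") auto
    then show ?thesis using p(1) by blast
  next
    case False
    then show ?thesis using that by (intro exI[of _ q]) auto
  qed
  define m where "m n = (SOME p. f p n \<noteq> 0 \<and> (\<forall>q. f q n \<noteq> 0 \<longrightarrow> \<bar>t q\<bar> \<le> \<bar>t p\<bar>))" for n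
  have m: "f (m n) n \<noteq> 0" "\<bar>t q\<bar> \<le> \<bar>t (m n)\<bar>" if "f q n \<noteq> 0" for q n
    using someI_ex[OF ex[OF that]] that unfolding m_def by blast+
  \<comment> \<open>Among the members with \<open>n\<close> in their support take one with the largest coefficient: this
    agrees eventually with every finite combination, without enumerating the support of \<open>t\<close>.\<close>
  define x where "x n = (if \<exists>q. f q n \<noteq> 0 then t (m n) * f (m n) n else 0)" for n
  have approx: "\<forall>\<^sub>F n in sequentially. \<bar>x n - comb {p. e \<le> \<bar>t p\<bar>} t n\<bar> < e" if e: "e > 0" for e
    using comb_eq_or_zero[OF fin[OF e], of t]
  proof eventually_elim
    case (elim n)
    let ?Q = "{p. e \<le> \<bar>t p\<bar>}"
    show ?case
    proof (cases "\<exists>q. f q n \<noteq> 0")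
      case True
      then obtain q where q: "f q n \<noteq> 0" by blast
      have mn: "f (m n) n \<noteq> 0" by (rule m(1)[OF q])
      show ?thesis
      proof (cases "m n \<in> ?Q")
        case True
        then have "comb ?Q t n = x n" using elim mn q by (auto simp: x_def)
        then show ?thesis using e by simp
      next
        case False
        then have "\<forall>p\<in>?Q. f p n = 0" using m(2)[of _ n] by force
        then have "comb ?Q t n = 0" using elim by blast
        moreover have "\<bar>x n\<bar> \<le> \<bar>t (m n)\<bar>"
          by (simp add: x_def abs_mult_f_le)
        ultimately show ?thesis using False by simp
      qed
    next
      case False
      then show ?thesis using e elim by (simp add: x_def)
    qed
  qed
  have x: "x \<in> twisted" using approx fin unfolding twisted_def by blast
  have "coef x p = t p" for p
  proof -
    have "\<bar>coef x p - t p\<bar> \<le> 0 + e" if e: "e > 0" for e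
    proof -
      have e2: "e / 2 > 0" using e by simp
      show ?thesis
      proof (cases "e / 2 \<le> \<bar>t p\<bar>")
        case True
        then show ?thesis using coef_comb[OF fin[OF e2] approx[OF e2] x, of p] e by simp
      next
        case False
        then have "\<bar>coef x p\<bar> \<le> e / 2" using coef_comb[OF fin[OF e2] approx[OF e2] x, of p] by simp
        then show ?thesis using False by linarith
      qed
    qed
    then have "\<bar>coef x p - t p\<bar> \<le> 0" by (rule field_le_epsilon)
    then show ?thesis by simp
  qed
  then show ?thesis using x by auto
qed

lemma short_exact_twisted_space:
  "short_exact_sequence (c0_space (UNIV :: nat set)) twisted_space (c0_space (UNIV :: real set)) id coef"
proof -
  have V: "vset twisted_space = twisted" by (simp add: twisted_space_def sup_normed_space_def)
  have "bounded_operator (c0_space (UNIV :: nat set)) twisted_space id"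
    unfolding bounded_operator_def
    using null_in_twisted vset_c0_nat_iff V
    by (auto simp: c0_space_def twisted_space_def sup_normed_space_def intro!: exI[of _ 1])
  moreover have "bounded_operator twisted_space (c0_space UNIV) coef"
    unfolding bounded_operator_def
  proof (intro conjI ballI allI exI)
    show "coef \<in> vset twisted_space \<rightarrow> vset (c0_space UNIV)" using coef_in_c0 V by blast
    fix x assume x: "x \<in> vset twisted_space"
    show "coef (vscale twisted_space a x) = vscale (c0_space UNIV) a (coef x)" for a
      using coef_scale x V by (auto simp: twisted_space_def c0_space_def sup_normed_space_def)
    have "sup_norm UNIV (coef x) \<le> sup_norm UNIV x"
      using abs_coef_le[of x] x V by (intro sup_norm_le) (auto intro: order.trans[OF abs_ge_zero])
    then show "vnorm (c0_space UNIV) (coef x) \<le> 1 * vnorm twisted_space x"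
      by (simp add: twisted_space_def c0_space_def sup_normed_space_def)
    fix y assume y: "y \<in> vset twisted_space"
    show "coef (vadd twisted_space x y) = vadd (c0_space UNIV) (coef x) (coef y)"
      using coef_add x y V by (auto simp: twisted_space_def c0_space_def sup_normed_space_def)
  qed
  moreover have "operator_kernel (c0_space (UNIV :: nat set)) twisted_space id = {vzero (c0_space UNIV)}"
    unfolding operator_kernel_def
    using vset_c0_nat_iff[of "\<lambda>_. 0"]
    by (auto simp: twisted_space_def c0_space_def sup_normed_space_def)
  moreover have "operator_kernel twisted_space (c0_space UNIV) coef = id ` vset (c0_space UNIV)"
  proof -
    have "vzero (c0_space (UNIV :: real set)) = (\<lambda>_. 0)"
      by (simp add: c0_space_def sup_normed_space_def)
    then show ?thesis
      unfolding operator_kernel_def V using null_iff_coef_zero null_in_twisted vset_c0_nat_iff by auto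
  qed
  moreover have "coef ` vset twisted_space = vset (c0_space UNIV)"
    unfolding V using coef_in_c0 coef_onto_c0 by blast
  ultimately show ?thesis
    unfolding short_exact_sequence_def by (simp add: banach_space_c0 banach_twisted_space)
qed

end

section \<open>The twisted sum is not a C-space\<close>

lemma countable_support_if_bounded_sums:
  fixes b :: "'i \<Rightarrow> real"
  assumes bound: "\<And>Q. finite Q \<Longrightarrow> (\<Sum>p\<in>Q. \<bar>b p\<bar>) \<le> B"
  shows "countable {p. b p \<noteq> 0}"
proof -
  have "(\<lambda>p. \<bar>b p\<bar>) summable_on UNIV"
    using bound by (intro nonneg_bdd_above_summable_on bdd_aboveI2[of _ _ B]) auto
  then have "countable {p \<in> UNIV. \<bar>b p\<bar> \<noteq> 0}" by (rule summable_countable_real)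
  then show ?thesis by simp
qed

text \<open>Composition with \<open>\<phi>(v) = max 0 (v / c - 1 / 2)\<close> sends \<open>c, -c, 0\<close> to \<open>1/2, 0, 0\<close>, which
  are not the values of an affine function of \<open>v\<close>.\<close>

lemma no_affine_correction:
  fixes v :: "nat \<Rightarrow> real"
  assumes c: "c \<noteq> 0" and v: "\<And>j. \<bar>v j - c * sign_pattern j\<bar> \<le> \<bar>c\<bar> / 8"
    and corr: "\<And>\<eta>. \<eta> > 0 \<Longrightarrow> \<exists>t u. convergent u \<and>
      (\<forall>j. \<bar>max 0 (v j / c - 1 / 2) - t * v j - u j\<bar> < \<eta>)"
  shows False
proof -
  obtain t u where u: "convergent u"
    and close: "\<And>j. \<bar>max 0 (v j / c - 1 / 2) - t * v j - u j\<bar> < 1 / 100"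
    using corr[of "1 / 100"] by auto
  obtain N where N: "\<And>i j. i \<ge> N \<Longrightarrow> j \<ge> N \<Longrightarrow> \<bar>u i - u j\<bar> < 1 / 100"
    using metric_CauchyD[OF convergent_Cauchy[OF u], of "1 / 100"] unfolding dist_real_def by auto
  define s where "s = t * c"
  define w where "w j = v j / c" for j
  have w: "\<bar>w j - sign_pattern j\<bar> \<le> 1 / 8" for j
  proof -
    have "\<bar>c\<bar> * \<bar>w j - sign_pattern j\<bar> = \<bar>v j - c * sign_pattern j\<bar>"
      using c by (simp add: w_def abs_mult[symmetric] right_diff_distrib)
    then have "\<bar>c\<bar> * \<bar>w j - sign_pattern j\<bar> \<le> \<bar>c\<bar> * (1 / 8)" using v[of j] by simp
    then show ?thesis using c by simp
  qed
  have sw: "t * v j = s * w j" for j using c by (simp add: s_def w_def)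
  have est: "\<bar>s * w j - s * sign_pattern j\<bar> \<le> \<bar>s\<bar> / 8" for j
    using mult_left_mono[OF w[of j], of "\<bar>s\<bar>"] by (simp add: abs_mult[symmetric] right_diff_distrib)
  define i where "i = 3 * N"
  have sp: "sign_pattern i = 1" "sign_pattern (i + 1) = - 1" "sign_pattern (i + 2) = 0"
    by (auto simp: sign_pattern_def i_def mod_Suc)
  have u_close: "\<bar>u i - u (i + 2)\<bar> < 1 / 100" "\<bar>u (i + 1) - u (i + 2)\<bar> < 1 / 100"
    by (rule N; simp add: i_def)+
  have val: "3 / 8 \<le> max 0 (w i - 1 / 2)" "max 0 (w (i + 1) - 1 / 2) = 0" "max 0 (w (i + 2) - 1 / 2) = 0"
    using w[of i] w[of "i + 1"] w[of "i + 2"] unfolding sp by linarith+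
  have d: "\<bar>max 0 (w i - 1 / 2) - s * w i - u i\<bar> < 1 / 100"
    "\<bar>s * w (i + 1) + u (i + 1)\<bar> < 1 / 100" "\<bar>s * w (i + 2) + u (i + 2)\<bar> < 1 / 100"
    using close[of i] close[of "i + 1"] close[of "i + 2"] unfolding sw w_def[symmetric] val(2,3) by linarith+
  have e: "\<bar>s * w i - s\<bar> \<le> \<bar>s\<bar> / 8" "\<bar>s * w (i + 1) + s\<bar> \<le> \<bar>s\<bar> / 8" "\<bar>s * w (i + 2)\<bar> \<le> \<bar>s\<bar> / 8"
    using est[of i] est[of "i + 1"] est[of "i + 2"] unfolding sp by simp_all
  \<comment> \<open>The points near \<open>-c\<close> and 0 both have image 0, which forces the
    slope \<open>s\<close> to be small. Then the image near \<open>c\<close> would have to be small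
    as well, but it is at least 3/8.\<close>
  have "\<bar>s * w (i + 1) - s * w (i + 2)\<bar> < 3 / 100" using d(2,3) u_close(2) by linarith
  then have "\<bar>s\<bar> < 1 / 25" using e(2,3) by linarith
  then have "\<bar>s * w i\<bar> < 1 / 20" "\<bar>u (i + 2)\<bar> < 1 / 50" using e(1,3) d(3) by linarith+
  then show False using d(1) val(1) u_close(1) by linarith
qed

context signed_almost_disjoint_family
begin

definition unit_vec :: "nat \<Rightarrow> nat \<Rightarrow> real" where
  "unit_vec m k = (if k = m then 1 else 0)"

lemma unit_vec_in_twisted: "unit_vec m \<in> twisted"
proof (rule null_in_twisted)
  have "\<forall>\<^sub>F k in sequentially. unit_vec m k = 0"
    using eventually_gt_at_top[of m] by (rule eventually_mono) (simp add: unit_vec_def)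
  then show "unit_vec m \<longlonglongrightarrow> 0" by (rule tendsto_eventually)
qed

text \<open>Each functional splits into the row describing it on \<open>c_0\<close> and a remainder
  vanishing on \<open>c_0\<close>. The remainders are nonzero at only countably many
  \<open>f p\<close>; the sequences of values there are handed to the test as \<open>g\<close>, and
  a tested index outside this set is then available.\<close>

lemma tested_functionals:
  fixes \<nu> :: "nat \<Rightarrow> (nat \<Rightarrow> real) \<Rightarrow> real"
  assumes tested: "\<And>a g. admissible a g \<Longrightarrow> uncountable {p. tests f p a g}"
    and add: "\<And>n x y. x \<in> twisted \<Longrightarrow> y \<in> twisted \<Longrightarrow> \<nu> n (\<lambda>k. x k + y k) = \<nu> n x + \<nu> n y"
    and scale: "\<And>n x c. x \<in> twisted \<Longrightarrow> \<nu> n (\<lambda>k. c * x k) = c * \<nu> n x"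
    and bound: "\<And>n x r. x \<in> twisted \<Longrightarrow> (\<And>k. \<bar>x k\<bar> \<le> r) \<Longrightarrow> \<bar>\<nu> n x\<bar> \<le> B * r" and B: "0 < B"
    and diag: "\<And>n. \<delta> \<le> \<bar>\<nu> n (unit_vec n)\<bar>" and \<delta>: "0 < \<delta>"
  shows "\<exists>p n c. c \<noteq> 0 \<and> (\<forall>j. \<bar>\<nu> (n j) (f p) - c * sign_pattern j\<bar> \<le> \<bar>c\<bar> / 8) \<and>
    (\<forall>x\<in>twisted. \<forall>\<eta>>0. \<exists>t u. convergent u \<and> (\<forall>j. \<bar>\<nu> (n j) x - t * \<nu> (n j) (f p) - u j\<bar> < \<eta>))"
proof -
  define a where "a n m = \<nu> n (unit_vec m)" for n m
  have sum: "(\<lambda>k. \<Sum>i\<in>I. s i * x i k) \<in> twisted \<and> \<nu> n (\<lambda>k. \<Sum>i\<in>I. s i * x i k) = (\<Sum>i\<in>I. s i * \<nu> n (x i))"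
    if "finite I" "\<And>i. x i \<in> twisted" for I :: "'i set" and s x n
    using that(1)
  proof (induction I rule: finite_induct)
    case empty
    have "(\<lambda>_. 0) \<in> twisted" by (rule null_in_twisted) simp
    then show ?case using scale[of "\<lambda>_. 0" n 0] by simp
  next
    case (insert i I)
    then show ?case
      using twisted_add[OF twisted_scale[OF that(2)[of i], of "s i"], of "\<lambda>k. \<Sum>i\<in>I. s i * x i k"]
        add[OF twisted_scale[OF that(2)[of i], of "s i"], of "\<lambda>k. \<Sum>i\<in>I. s i * x i k" n]
        scale[OF that(2)[of i], of n "s i"] by simp
  qed
  have trunc: "(\<lambda>k. if k < N then s k else 0) \<in> twisted"
    "\<nu> n (\<lambda>k. if k < N then s k else 0) = (\<Sum>m<N. s m * a n m)" for N s n
  proof -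
    have "(\<lambda>k. \<Sum>m<N. s m * unit_vec m k) = (\<lambda>k. if k < N then s k else 0)"
      by (auto simp: unit_vec_def if_distrib cong: if_cong)
    then show "(\<lambda>k. if k < N then s k else 0) \<in> twisted"
      "\<nu> n (\<lambda>k. if k < N then s k else 0) = (\<Sum>m<N. s m * a n m)"
      using sum[of "{..<N}" unit_vec s n] unit_vec_in_twisted by (simp_all add: a_def)
  qed
  have comb: "comb Q t \<in> twisted" "\<nu> n (comb Q t) = (\<Sum>q\<in>Q. t q * \<nu> n (f q))" if "finite Q" for Q t n
    using sum[OF that, of f t n] f_in_twisted unfolding comb_def[abs_def] by auto
  \<comment> \<open>Deleting the first \<open>L\<close> coordinates makes an eventually small
    difference uniformly small, at the cost of a finite combination of columns of
    \<open>a\<close>.\<close>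
  have tail: "\<nu> n (\<lambda>k. if k < L then 0 else x k - comb Q t k)
      = \<nu> n x - (\<Sum>q\<in>Q. t q * \<nu> n (f q)) - (\<Sum>m<L. (x m - comb Q t m) * a n m)"
    "(\<lambda>k. if k < L then 0 else x k - comb Q t k) \<in> twisted"
    if "x \<in> twisted" "finite Q" for n L x Q t
  proof -
    let ?z = "\<lambda>k. if k < L then x k - comb Q t k else 0"
    have eq: "(\<lambda>k. if k < L then 0 else x k - comb Q t k) = (\<lambda>k. (x k + (- 1) * comb Q t k) + (- 1) * ?z k)"
      by auto
    have 1: "(\<lambda>k. (- 1) * comb Q t k) \<in> twisted" "(\<lambda>k. (- 1) * ?z k) \<in> twisted"
      by (rule twisted_scale comb(1)[OF that(2)] trunc(1))+
    show "(\<lambda>k. if k < L then 0 else x k - comb Q t k) \<in> twisted"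
      unfolding eq by (intro twisted_add that(1) 1)
    show "\<nu> n (\<lambda>k. if k < L then 0 else x k - comb Q t k)
      = \<nu> n x - (\<Sum>q\<in>Q. t q * \<nu> n (f q)) - (\<Sum>m<L. (x m - comb Q t m) * a n m)"
      unfolding eq add[OF twisted_add[OF that(1) 1(1)] 1(2)] add[OF that(1) 1(1)]
        scale[OF comb(1)[OF that(2)]] scale[OF trunc(1)] comb(2)[OF that(2)] trunc(2)
      by simp
  qed
  have row: "(\<Sum>m<N. \<bar>a n m\<bar>) \<le> B" for n N
  proof -
    \<comment> \<open>Evaluation at the truncated sign vector of the row turns the norm bound on
      \<open>\<nu> n\<close> into an l_1 bound.\<close>
    have "(\<Sum>m<N. \<bar>a n m\<bar>) = \<nu> n (\<lambda>k. if k < N then sgn (a n k) else 0)"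
      unfolding trunc(2) by (intro sum.cong) (simp_all add: abs_sgn)
    also have "\<dots> \<le> \<bar>\<nu> n (\<lambda>k. if k < N then sgn (a n k) else 0)\<bar>" by (rule abs_ge_self)
    also have "\<dots> \<le> B * 1" by (rule bound[OF trunc(1)]) (simp add: abs_sgn_eq)
    finally show ?thesis by simp
  qed
  have summ: "summable (\<lambda>m. \<bar>a n m\<bar>)" for n by (rule summableI_nonneg_bounded[OF _ row]) simp
  have fsum: "summable (\<lambda>m. a n m * f q m)" for n q by (rule summable_mult_bounded[OF summ abs_f_le])
  define b where "b n p = \<nu> n (f p) - (\<Sum>m. a n m * f p m)" for n p
  have "countable {p. b n p \<noteq> 0}" for n
  proof (rule countable_support_if_bounded_sums)
    fix Q :: "real set" assume Q: "finite Q"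
    \<comment> \<open>Far out, the combination with coefficients \<open>s\<close> is bounded by 1 by almost disjointness, and
      \<open>\<nu> n\<close> of its tails converges to the sum to be estimated.\<close>
    define s where "s q = - sgn (b n q)" for q
    have z: "(\<lambda>_. 0) \<in> twisted" by (rule null_in_twisted) simp
    have z0: "\<nu> n (\<lambda>_. 0) = 0" using scale[OF z, of n 0] by simp
    have "(\<lambda>L. \<Sum>q\<in>Q. s q * (\<nu> n (f q) - (\<Sum>m<L. a n m * f q m))) \<longlonglongrightarrow> (\<Sum>q\<in>Q. s q * b n q)"
      unfolding b_def by (intro tendsto_intros summable_LIMSEQ fsum)
    moreover have "\<forall>\<^sub>F L in sequentially. - B \<le> (\<Sum>q\<in>Q. s q * (\<nu> n (f q) - (\<Sum>m<L. a n m * f q m)))"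
    proof -
      have "\<forall>\<^sub>F k in sequentially. \<bar>comb Q s k\<bar> \<le> 1"
        using comb_eq_or_zero[OF Q, of s]
      proof eventually_elim
        case (elim k)
        show ?case
        proof (cases "\<forall>q\<in>Q. f q k = 0")
          case False
          then obtain q where "q \<in> Q" "f q k \<noteq> 0" by blast
          then have "comb Q s k = s q * f q k" using elim by blast
          moreover have "\<bar>s q\<bar> \<le> 1" by (simp add: s_def abs_sgn_eq)
          ultimately show ?thesis using abs_mult_f_le[of "s q" q k] by linarith
        qed (use elim in simp)
      qed
      then obtain L0 where L0: "\<And>k. k \<ge> L0 \<Longrightarrow> \<bar>comb Q s k\<bar> \<le> 1" by (auto simp: eventually_sequentially)
      have "- B \<le> (\<Sum>q\<in>Q. s q * (\<nu> n (f q) - (\<Sum>m<L. a n m * f q m)))" if "L \<ge> L0" for L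
      proof -
        have "(\<Sum>m<L. comb Q s m * a n m) = (\<Sum>q\<in>Q. s q * (\<Sum>m<L. a n m * f q m))"
          unfolding comb_def sum_distrib_left sum_distrib_right
          by (subst sum.swap) (simp add: mult_ac)
        then have "\<nu> n (\<lambda>k. if k < L then 0 else 0 - comb Q s k)
            = - (\<Sum>q\<in>Q. s q * (\<nu> n (f q) - (\<Sum>m<L. a n m * f q m)))"
          unfolding tail(1)[OF z Q] z0
          by (simp add: right_diff_distrib sum_subtractf sum_negf)
        moreover have "\<bar>\<nu> n (\<lambda>k. if k < L then 0 else 0 - comb Q s k)\<bar> \<le> B * 1"
          using L0 \<open>L \<ge> L0\<close> by (intro bound tail(2)[OF z Q]) auto
        ultimately show ?thesis by linarith
      qed
      then show ?thesis unfolding eventually_sequentially by blast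
    qed
    ultimately have "- B \<le> (\<Sum>q\<in>Q. s q * b n q)" by (rule tendsto_lowerbound) simp
    also have "\<dots> = - (\<Sum>q\<in>Q. \<bar>b n q\<bar>)"
      unfolding sum_negf[symmetric] by (intro sum.cong) (simp_all add: s_def abs_sgn mult.commute)
    finally show "(\<Sum>q\<in>Q. \<bar>b n q\<bar>) \<le> B" by simp
  qed
  then have D: "countable (\<Union>n. {p. b n p \<noteq> 0})" (is "countable ?D") by simp
  \<comment> \<open>If \<open>?D\<close> is empty, \<open>from_nat_into\<close> returns an
    unspecified index; the sequence is bounded in that case too.\<close>
  define g where "g i n = \<nu> n (f (from_nat_into ?D i))" for i n
  have "admissible a g"
    unfolding admissible_def
  proof (intro conjI exI allI)
    show "summable (\<lambda>m. \<bar>a n m\<bar>)" "(\<Sum>m. \<bar>a n m\<bar>) \<le> B" for n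
      using summ row by (auto intro: suminf_le_const)
    show "0 < \<delta>" "\<delta> \<le> \<bar>a n n\<bar>" for n using \<delta> diag by (simp_all add: a_def)
    show "Bseq (g i)" for i
      using bound[OF f_in_twisted abs_f_le] by (intro BseqI'[of _ B]) (simp add: g_def)
  qed
  from tested[OF this] D have "\<not> {p. tests f p a g} \<subseteq> ?D" using countable_subset by blast
  then obtain p where p: "p \<notin> ?D" "tests f p a g" by blast
  obtain n c where nc: "tested_along a g (f p) n c"
    and others: "\<And>q. q \<noteq> p \<Longrightarrow> convergent (\<lambda>j. \<Sum>m. a (n j) m * f q m)"
    using p(2) unfolding tests_def by blast
  have outside: "\<nu> k (f q) = (\<Sum>m. a k m * f q m)" if "q \<notin> ?D" for k q
    using that by (simp add: b_def)
  have conv: "convergent (\<lambda>j. \<nu> (n j) (f q))" if "q \<noteq> p" for q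
  proof (cases "q \<in> ?D")
    case True
    then obtain i where "q = from_nat_into ?D i" using from_nat_into_surj[OF D] by metis
    then show ?thesis using nc by (auto simp: tested_along_def g_def)
  next
    case False
    show ?thesis unfolding outside[OF False] by (rule others[OF that])
  qed
  have "\<exists>t u. convergent u \<and> (\<forall>j. \<bar>\<nu> (n j) x - t * \<nu> (n j) (f p) - u j\<bar> < \<eta>)"
    if x: "x \<in> twisted" and \<eta>: "\<eta> > 0" for x \<eta>
  proof -
    have "\<eta> / (2 * B) > 0" using \<eta> B by simp
    then obtain Q t where Q: "finite Q" "\<forall>\<^sub>F k in sequentially. \<bar>x k - comb Q t k\<bar> < \<eta> / (2 * B)"
      using twistedE[OF x] by blast
    then obtain L where L: "\<And>k. k \<ge> L \<Longrightarrow> \<bar>x k - comb Q t k\<bar> < \<eta> / (2 * B)"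
      by (auto simp: eventually_sequentially)
    \<comment> \<open>The factor is the coefficient of \<open>f p\<close> in the approximating
      combination. All other members and the finite head converge along \<open>n\<close> and form
      the correction \<open>?u\<close>.\<close>
    let ?t = "if p \<in> Q then t p else 0"
    let ?u = "\<lambda>j. (\<Sum>q\<in>Q - {p}. t q * \<nu> (n j) (f q)) + (\<Sum>m<L. (x m - comb Q t m) * a (n j) m)"
    have "\<bar>\<nu> (n j) x - ?t * \<nu> (n j) (f p) - ?u j\<bar> < \<eta>" for j
    proof -
      have "(\<Sum>q\<in>Q. t q * \<nu> (n j) (f q)) = ?t * \<nu> (n j) (f p) + (\<Sum>q\<in>Q - {p}. t q * \<nu> (n j) (f q))"
        using sum.remove[OF Q(1), of p "\<lambda>q. t q * \<nu> (n j) (f q)"] by simp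
      then have "\<nu> (n j) x - ?t * \<nu> (n j) (f p) - ?u j
          = \<nu> (n j) (\<lambda>k. if k < L then 0 else x k - comb Q t k)"
        unfolding tail(1)[OF x Q(1)] by linarith
      moreover have "\<bar>\<nu> (n j) (\<lambda>k. if k < L then 0 else x k - comb Q t k)\<bar> \<le> B * (\<eta> / (2 * B))"
      proof (rule bound[OF tail(2)[OF x Q(1)]])
        show "\<bar>if k < L then 0 else x k - comb Q t k\<bar> \<le> \<eta> / (2 * B)" for k
          using L[of k] \<eta> B by (cases "k < L") (auto simp: less_imp_le)
      qed
      moreover have "B * (\<eta> / (2 * B)) < \<eta>" using \<eta> B by simp
      ultimately show ?thesis by linarith
    qed
    moreover have "convergent ?u"
      using nc conv unfolding tested_along_def
      by (intro convergent_add convergent_sum convergent_mult convergent_const) auto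
    ultimately show ?thesis by blast
  qed
  then show ?thesis
    using nc outside[OF p(1)] unfolding tested_along_def by (intro exI[of _ p] exI[of _ n] exI[of _ c]) simp
qed

theorem not_C_space_twisted_space:
  assumes tested: "\<And>a g. admissible a g \<Longrightarrow> uncountable {p. tests f p a g}"
  shows "\<not> C_space twisted_space"
proof
  assume "C_space twisted_space"
  then obtain K :: "((nat \<Rightarrow> real) \<Rightarrow> real) topology" and T S where K: "compact_space K"
    and T: "bounded_operator twisted_space (C_of K) T" and S: "bounded_operator (C_of K) twisted_space S"
    and ST: "\<And>x. x \<in> vset twisted_space \<Longrightarrow> S (T x) = x" and TS: "\<And>h. h \<in> vset (C_of K) \<Longrightarrow> T (S h) = h"
    unfolding C_space_def isomorphic_spaces_def by blast
  have V: "vset twisted_space = twisted" "vadd twisted_space = (\<lambda>x y k. x k + y k)"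
    "vscale twisted_space = (\<lambda>a x k. a * x k)" "vnorm twisted_space = sup_norm UNIV"
    by (simp_all add: twisted_space_def sup_normed_space_def)
  have W: "vset (C_of K) = {h. continuous_map K euclideanreal h \<and> (\<forall>s. s \<notin> topspace K \<longrightarrow> h s = 0)}"
    "vadd (C_of K) = (\<lambda>x y k. x k + y k)"
    "vscale (C_of K) = (\<lambda>a x k. a * x k)" "vnorm (C_of K) = sup_norm (topspace K)"
    by (simp_all add: C_of_def sup_normed_space_def)
  obtain B0 where B0: "\<And>x. x \<in> twisted \<Longrightarrow> sup_norm (topspace K) (T x) \<le> B0 * sup_norm UNIV x"
    using T unfolding bounded_operator_def V W(4) by blast
  obtain C0 where C0: "\<And>h. h \<in> vset (C_of K) \<Longrightarrow> sup_norm UNIV (S h) \<le> C0 * sup_norm (topspace K) h"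
    using S unfolding bounded_operator_def V W(4) by blast
  define B where "B = \<bar>B0\<bar> + 1"
  define C where "C = \<bar>C0\<bar> + 1"
  have pos: "B > 0" "C > 0" by (simp_all add: B_def C_def)
  have Tmem: "T x \<in> vset (C_of K)" if "x \<in> twisted" for x
    using T that unfolding bounded_operator_def V by blast
  have T_le: "\<bar>T x k\<bar> \<le> B * r" if x: "x \<in> twisted" and r: "\<And>i. \<bar>x i\<bar> \<le> r" for x k r
  proof -
    have r0: "0 \<le> r" using r[of 0] by linarith
    show ?thesis
    proof (cases "k \<in> topspace K")
      case True
      obtain A where A: "\<And>s. s \<in> topspace K \<Longrightarrow> \<bar>T x s\<bar> \<le> A"
        using bounded_on_compact_space[OF K, of "T x"] Tmem[OF x] unfolding W by blast
      have "\<bar>T x k\<bar> \<le> sup_norm (topspace K) (T x)" by (rule abs_le_sup_norm[OF A True])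
      also have "\<dots> \<le> B0 * sup_norm UNIV x" by (rule B0[OF x])
      also have "\<dots> \<le> B * sup_norm UNIV x"
        using sup_norm_nonneg[of UNIV x r] r by (intro mult_right_mono) (auto simp: B_def)
      also have "\<dots> \<le> B * r" using pos(1) r r0 by (intro mult_left_mono sup_norm_le) auto
      finally show ?thesis .
    next
      case False
      then show ?thesis using Tmem[OF x] r0 pos(1) unfolding W by simp
    qed
  qed
  \<comment> \<open>Otherwise applying \<open>S\<close> to \<open>T (unit_vec m)\<close> would
    return a vector of norm at most 1/2, whereas \<open>unit_vec m\<close> has norm at least
    1.\<close>
  have "\<exists>k. 1 / (2 * C) \<le> \<bar>T (unit_vec m) k\<bar>" for m
  proof (rule ccontr)
    assume "\<not> ?thesis"
    then have "sup_norm (topspace K) (T (unit_vec m)) \<le> 1 / (2 * C)"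
      using pos(2) by (intro sup_norm_le) (auto simp: not_le less_imp_le)
    then have "C0 * sup_norm (topspace K) (T (unit_vec m)) \<le> C * (1 / (2 * C))"
      using T_le[OF unit_vec_in_twisted[of m], of 1]
      by (intro mult_mono sup_norm_nonneg[of _ _ "B * 1"]) (auto simp: C_def unit_vec_def)
    then have "sup_norm UNIV (unit_vec m) \<le> 1 / 2"
      using C0[OF Tmem[OF unit_vec_in_twisted[of m]]] ST[of "unit_vec m"] unit_vec_in_twisted[of m] pos(2) V
      by simp
    then show False
      using abs_le_norm[OF unit_vec_in_twisted[of m], of m] by (simp add: unit_vec_def)
  qed
  then obtain \<kappa> where \<kappa>: "\<And>m. 1 / (2 * C) \<le> \<bar>T (unit_vec m) (\<kappa> m)\<bar>" by metis
  have Tadd: "T (\<lambda>k. x k + y k) = (\<lambda>k. T x k + T y k)" if "x \<in> twisted" "y \<in> twisted" for x y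
    using T that unfolding bounded_operator_def V W by blast
  have Tscale: "T (\<lambda>k. c * x k) = (\<lambda>k. c * T x k)" if "x \<in> twisted" for x c
    using T that unfolding bounded_operator_def V W by blast
  have "\<exists>p n c. c \<noteq> 0 \<and> (\<forall>j. \<bar>T (f p) (\<kappa> (n j)) - c * sign_pattern j\<bar> \<le> \<bar>c\<bar> / 8) \<and>
    (\<forall>x\<in>twisted. \<forall>\<eta>>0. \<exists>t u. convergent u \<and>
      (\<forall>j. \<bar>T x (\<kappa> (n j)) - t * T (f p) (\<kappa> (n j)) - u j\<bar> < \<eta>))"
    by (rule tested_functionals[of "\<lambda>n x. T x (\<kappa> n)" B "1 / (2 * C)"])
      (use tested T_le pos \<kappa> Tadd Tscale in auto)
  then obtain p n c where c: "c \<noteq> 0" "\<And>j. \<bar>T (f p) (\<kappa> (n j)) - c * sign_pattern j\<bar> \<le> \<bar>c\<bar> / 8"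
    and corr: "\<And>x \<eta>. x \<in> twisted \<Longrightarrow> \<eta> > 0 \<Longrightarrow> \<exists>t u. convergent u \<and>
      (\<forall>j. \<bar>T x (\<kappa> (n j)) - t * T (f p) (\<kappa> (n j)) - u j\<bar> < \<eta>)" by blast
  \<comment> \<open>\<open>C(K)\<close> is closed under composition with a continuous function, so
    \<open>S h\<close> lies in the twisted sum; its values at the chosen points contradict the
    affine approximation.\<close>
  define h where "h k = max 0 (T (f p) k / c - 1 / 2)" for k
  have Tf: "continuous_map K euclideanreal (T (f p))" "\<And>k. k \<notin> topspace K \<Longrightarrow> T (f p) k = 0"
    using Tmem[OF f_in_twisted[of p]] unfolding W by auto
  have "continuous_map euclideanreal euclideanreal (\<lambda>v. max 0 (v / c - 1 / 2))"
    using c(1) by (auto intro!: continuous_intros)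
  from continuous_map_compose[OF Tf(1) this] have "continuous_map K euclideanreal h"
    by (simp add: h_def[abs_def] o_def)
  \<comment> \<open>Off \<open>topspace K\<close> the value is \<open>max 0 (- 1 / 2) = 0\<close>,
    so \<open>h\<close> obeys the convention of vanishing there.\<close>
  then have h: "h \<in> vset (C_of K)" using Tf(2) by (simp add: W h_def)
  have Sh: "S h \<in> twisted" using S h unfolding bounded_operator_def V by blast
  show False
  proof (rule no_affine_correction[OF c])
    fix \<eta> :: real assume "\<eta> > 0"
    from corr[OF Sh this]
    show "\<exists>t u. convergent u \<and> (\<forall>j. \<bar>max 0 (T (f p) (\<kappa> (n j)) / c - 1 / 2)
        - t * T (f p) (\<kappa> (n j)) - u j\<bar> < \<eta>)"
      unfolding TS[OF h] h_def .
  qed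
qed

end

theorem mainTheorem2:
  shows "\<exists>(X :: (nat \<Rightarrow> real) normed_struct) (i :: (nat \<Rightarrow> real) \<Rightarrow> (nat \<Rightarrow> real))
            (q :: (nat \<Rightarrow> real) \<Rightarrow> (real \<Rightarrow> real)).
           banach_space X \<and> \<not> C_space X \<and>
           short_exact_sequence (c0_space (UNIV :: nat set)) X (c0_space (UNIV :: real set)) i q"
proof -
  obtain f where f: "signed_almost_disjoint_family f"
    and tested: "\<And>a g. admissible a g \<Longrightarrow> uncountable {p. tests f p a g}"
    using testing_family_exists by blast
  interpret signed_almost_disjoint_family f by (rule f)
  show ?thesis
    using banach_twisted_space not_C_space_twisted_space[OF tested] short_exact_twisted_space by blast
qed

end
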